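(* Let $D=\mathbb{Z}[\omega]$ with $\omega=\frac{-1+i\sqrt{3}}{2}$. Let $\pi_1,\pi_2\in D$ be primary primes with $N\pi_1\neq 3$, $N\pi_2\neq 3$ and $N\pi_1\neq N\pi_2$. Then $$\chi_{\pi_1}(\pi_2)=\chi_{\pi_2}(\pi_1).$$
   Context: For $\alpha=a+b\omega\in D$ with $a,b\in\mathbb{Z}$, the norm is $N\alpha=\alpha\overline{\alpha}=a^2-ab+b^2$. A prime $\pi\in D$ is called primary if $\pi\equiv 2\pmod 3$ in $D$ (i.e. $\pi=a+b\omega$ with $a\equiv 2$, $b\equiv 0\pmod 3$). For a prime $\pi\in D$ with $N\pi\ne 3$, the cubic residue character $\chi_\pi$ on $D$ is defined by: $\chi_\pi(\alpha)=0$ if $\pi\mid\alpha$; otherwise $\chi_\pi(\alpha)$ is the unique element of $\{1,\omega,\omega^2\}$ with $\alpha^{(N\pi-1)/3}\equiv\chi_\pi(\alpha)\pmod{\pi}$. *)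

theory Defs
  imports Complex_Main "HOL-Computational_Algebra.Factorial_Ring"
begin

definition omega :: complex where
  "omega = (- 1 + \<i> * of_real (sqrt 3)) / 2"

lemma Re_omega [simp]: "Re omega = - 1 / 2"
  and Im_omega [simp]: "Im omega = sqrt 3 / 2"
  by (simp_all add: omega_def)

lemma omega_square: "omega * omega = - 1 - omega"
  by (simp add: complex_eq_iff field_simps)

text \<open>The ring \<open>D = \<int>[\<omega>]\<close>, as a type.\<close>

typedef eisenstein = "{of_int a + of_int b * omega | a b :: int. True}"
  morphisms complex_of_eis Abs_eisenstein
  by auto

setup_lifting type_definition_eisenstein

lift_definition Eis :: "int \<Rightarrow> int \<Rightarrow> eisenstein" is "\<lambda>a b. of_int a + of_int b * omega"
  by blast

lemma complex_of_Eis: "complex_of_eis (Eis a b) = of_int a + of_int b * omega"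
  by (fact Eis.rep_eq)

lemma Eis_cases [cases type: eisenstein]:
  obtains a b where "\<alpha> = Eis a b"
proof -
  have "\<exists>a b. \<alpha> = Eis a b"
    by transfer blast
  with that show ?thesis by blast
qed

lemma Eis_eq_iff [simp]: "Eis a b = Eis c d \<longleftrightarrow> a = c \<and> b = d"
  by transfer (auto simp: complex_eq_iff)

lemma
  fixes z w :: complex
  assumes "\<exists>a b. z = of_int a + of_int b * omega" and "\<exists>a b. w = of_int a + of_int b * omega"
  shows Eis_closed_plus: "\<exists>a b. z + w = of_int a + of_int b * omega"
    and Eis_closed_minus: "\<exists>a b. z - w = of_int a + of_int b * omega"
    and Eis_closed_times: "\<exists>a b. z * w = of_int a + of_int b * omega"
proof -
  obtain a b c d where zw: "z = of_int a + of_int b * omega" "w = of_int c + of_int d * omega"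
    using assms by blast
  have "z + w = of_int (a + c) + of_int (b + d) * omega"
    by (simp add: zw algebra_simps)
  then show "\<exists>a b. z + w = of_int a + of_int b * omega" by blast
  have "z - w = of_int (a - c) + of_int (b - d) * omega"
    by (simp add: zw algebra_simps)
  then show "\<exists>a b. z - w = of_int a + of_int b * omega" by blast
  have "z * w = of_int a * of_int c + (of_int a * of_int d + of_int b * of_int c) * omega
      + of_int b * of_int d * (omega * omega)"
    by (simp add: zw algebra_simps)
  also have "\<dots> = of_int (a * c - b * d) + of_int (a * d + b * c - b * d) * omega"
    unfolding omega_square by (simp add: algebra_simps)
  finally show "\<exists>a b. z * w = of_int a + of_int b * omega" by blast
qed

lemma Eis_closed_0: "\<exists>a b. (0::complex) = of_int a + of_int b * omega"
  by (intro exI[of _ 0]) simp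

lemma Eis_closed_1: "\<exists>a b. (1::complex) = of_int a + of_int b * omega"
  by (rule exI[of _ 1], rule exI[of _ 0]) simp

instantiation eisenstein :: idom
begin

lift_definition zero_eisenstein :: eisenstein is 0
  using Eis_closed_0 by simp

lift_definition one_eisenstein :: eisenstein is 1
  using Eis_closed_1 by simp

lift_definition uminus_eisenstein :: "eisenstein \<Rightarrow> eisenstein" is uminus
  using Eis_closed_minus[OF Eis_closed_0] by auto

lift_definition plus_eisenstein :: "eisenstein \<Rightarrow> eisenstein \<Rightarrow> eisenstein" is "(+)"
  using Eis_closed_plus by auto

lift_definition minus_eisenstein :: "eisenstein \<Rightarrow> eisenstein \<Rightarrow> eisenstein" is "(-)"
  using Eis_closed_minus by auto

lift_definition times_eisenstein :: "eisenstein \<Rightarrow> eisenstein \<Rightarrow> eisenstein" is "(*)"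
  using Eis_closed_times by auto

instance
  by standard (transfer; simp add: algebra_simps)+

end

lemma Eis_times: "Eis a b * Eis c d = Eis (a * c - b * d) (a * d + b * c - b * d)"
proof -
  have "complex_of_eis (Eis a b * Eis c d)
      = of_int a * of_int c + (of_int a * of_int d + of_int b * of_int c) * omega
      + of_int b * of_int d * (omega * omega)"
    by (simp add: times_eisenstein.rep_eq complex_of_Eis algebra_simps)
  also have "\<dots> = complex_of_eis (Eis (a * c - b * d) (a * d + b * c - b * d))"
    unfolding omega_square by (simp add: complex_of_Eis algebra_simps)
  finally show ?thesis
    by (simp add: complex_of_eis_inject)
qed

lemma Eis_plus: "Eis a b + Eis c d = Eis (a + c) (b + d)"
  by transfer (simp add: algebra_simps)

lemma Eis_minus: "Eis a b - Eis c d = Eis (a - c) (b - d)"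
  by transfer (simp add: algebra_simps)

lemma of_int_eis: "of_int a = Eis a 0"
proof -
  have nat: "of_nat n = Eis (int n) 0" for n
  proof (induction n)
    case 0
    show ?case by simp (transfer, simp)
  next
    case (Suc n)
    have one: "1 = Eis 1 0" by transfer simp
    show ?case by (simp add: Suc one Eis_plus)
  qed
  have neg: "- Eis c 0 = Eis (- c) 0" for c
    by transfer simp
  show ?thesis
    by (cases a rule: int_cases2) (simp_all add: nat neg)
qed

definition eis_omega :: eisenstein where
  "eis_omega = Eis 0 1"

lemma complex_of_eis_omega: "complex_of_eis eis_omega = omega"
  by (simp add: eis_omega_def complex_of_Eis)

definition eis_norm :: "eisenstein \<Rightarrow> int" where
  "eis_norm \<alpha> = (THE n. of_int n = complex_of_eis \<alpha> * cnj (complex_of_eis \<alpha>))"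

lemma eis_norm_Eis: "eis_norm (Eis a b) = a\<^sup>2 - a * b + b\<^sup>2"
proof -
  have *: "of_int (a\<^sup>2 - a * b + b\<^sup>2) = complex_of_eis (Eis a b) * cnj (complex_of_eis (Eis a b))"
    by (simp add: complex_of_Eis complex_eq_iff power2_eq_square field_simps)
  show ?thesis
    unfolding eis_norm_def *[symmetric] of_int_eq_iff by simp
qed

lemma of_int_eis_norm: "of_int (eis_norm \<alpha>) = complex_of_eis \<alpha> * cnj (complex_of_eis \<alpha>)"
  by (cases \<alpha>)
    (simp add: eis_norm_Eis complex_of_Eis complex_eq_iff power2_eq_square field_simps)

definition eis_cong :: "eisenstein \<Rightarrow> eisenstein \<Rightarrow> eisenstein \<Rightarrow> bool" where
  "eis_cong \<alpha> \<beta> \<mu> \<longleftrightarrow> \<mu> dvd \<alpha> - \<beta>"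

definition primary :: "eisenstein \<Rightarrow> bool" where
  "primary \<pi> \<longleftrightarrow> eis_cong \<pi> 2 3"

lemma primary_Eis: "primary (Eis a b) \<longleftrightarrow> a mod 3 = 2 \<and> b mod 3 = 0"
proof -
  have n2: "2 = Eis 2 0" and n3: "3 = Eis 3 0"
    using of_int_eis[of 2] of_int_eis[of 3] by simp_all
  have "primary (Eis a b) \<longleftrightarrow> (\<exists>c d. Eis (a - 2) b = Eis (3 * c) (3 * d))"
    unfolding primary_def eis_cong_def n2 n3 Eis_minus dvd_def
    by (metis Eis_cases Eis_times diff_zero mult_zero_left add.right_neutral)
  also have "\<dots> \<longleftrightarrow> 3 dvd a - 2 \<and> 3 dvd b"
    by (auto simp: dvd_def)
  also have "\<dots> \<longleftrightarrow> a mod 3 = 2 \<and> b mod 3 = 0"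
    by presburger
  finally show ?thesis .
qed

text \<open>
  Only meant for \<open>\<pi>\<close> prime with \<open>N\<pi> \<noteq> 3\<close>: then \<open>3\<close> divides \<open>N\<pi> - 1\<close> and the
  definite description picks the unique cube root of unity with the required congruence.
\<close>

definition cubic_char :: "eisenstein \<Rightarrow> eisenstein \<Rightarrow> eisenstein" where
  "cubic_char \<pi> \<alpha> =
    (if \<pi> dvd \<alpha> then 0
     else THE \<zeta>. \<zeta> \<in> {1, eis_omega, eis_omega\<^sup>2} \<and>
            eis_cong (\<alpha> ^ nat ((eis_norm \<pi> - 1) div 3)) \<zeta> \<pi>)"

end

theory Submission
  imports "HOL-Number_Theory.Residue_Primitive_Roots" Defs "HOL-Computational_Algebra.Polynomial"
begin

text \<open>
  Let \<open>\<pi>\<close> have prime norm \<open>p\<close> and let \<open>\<chi>\<close> be the cubic character modulo \<open>\<pi>\<close>, restricted to the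
  integers. Its Gauss sum \<open>g = \<Sum>\<^sub>t \<chi>(t) X\<^sup>t\<close> is taken in the group ring \<open>D[X] / (X\<^sup>p - 1)\<close> rather than
  at a complex root of unity, so that congruences can be read off from coefficients in \<open>D\<close>.
  There \<open>g\<^sup>3 = J (p - \<Sum>\<^sub>t X\<^sup>t)\<close> with \<open>J\<close> the Jacobi sum, hence \<open>g\<^sup>4 = p J g\<close>; moreover \<open>J = \<pi>\<close>,
  because \<open>J \<equiv> 2\<close> modulo \<open>3\<close>, \<open>\<pi>\<close> divides \<open>J\<close> and both have norm \<open>p\<close>.
  Comparing with the Frobenius congruence \<open>g\<^sup>q \<equiv> \<chi>(q)\<^sup>-\<^sup>1 g\<close> modulo a prime \<open>q \<equiv> 1\<close> modulo \<open>3\<close>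
  (or with its iterate for \<open>q \<equiv> 2\<close>) gives \<open>(p \<pi>)\<^sup>k \<equiv> \<chi>(q)\<^sup>2\<close> with \<open>k = (q - 1) / 3\<close>
  (or \<open>(p \<pi>)\<^sup>k \<equiv> \<chi>(q)\<close> with \<open>k = (q\<^sup>2 - 1) / 3\<close>). For two primes of prime norms \<open>p\<^sub>1\<close>, \<open>p\<^sub>2\<close> this
  expresses both \<open>\<chi>\<^sub>1(\<pi>\<^sub>2)\<close> and \<open>\<chi>\<^sub>2(\<pi>\<^sub>1)\<close> as \<open>\<chi>\<^sub>1(p\<^sub>2)\<^sup>2 \<chi>\<^sub>2(p\<^sub>1)\<^sup>2\<close>. The inert primes are the
  rational primes \<open>q \<equiv> 2\<close> modulo \<open>3\<close>, whose character is trivial on integers prime to \<open>q\<close>.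
\<close>

subsection \<open>Congruences in commutative rings\<close>

lemma prime_dvd_add_power_diff:
  fixes x y :: "'a :: comm_ring_1"
  assumes "prime q"
  shows "of_nat q dvd (x + y) ^ q - (x ^ q + y ^ q)"
proof -
  have q: "q > 0" using assms prime_gt_0_nat by blast
  have "(x + y) ^ q = (\<Sum>k\<le>q. of_nat (q choose k) * x ^ k * y ^ (q - k))"
    by (rule binomial_ring)
  also have "{..q} = insert 0 (insert q {0<..<q})"
    using q by auto
  also have "(\<Sum>k\<in>\<dots>. of_nat (q choose k) * x ^ k * y ^ (q - k))
      = x ^ q + y ^ q + (\<Sum>k\<in>{0<..<q}. of_nat (q choose k) * x ^ k * y ^ (q - k))"
    using q by simp
  finally have "(x + y) ^ q - (x ^ q + y ^ q)
      = (\<Sum>k\<in>{0<..<q}. of_nat (q choose k) * x ^ k * y ^ (q - k))"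
    by simp
  moreover have "of_nat q dvd (of_nat (q choose k) :: 'a)" if "k \<in> {0<..<q}" for k
  proof -
    have "q dvd q choose k"
      using that assms by (intro dvd_choose_prime) auto
    then show ?thesis by (metis dvd_def of_nat_mult)
  qed
  ultimately show ?thesis
    by (auto intro!: dvd_sum dvd_mult2)
qed

text \<open>The ring is arbitrary because the congruence is applied to the integers in
  \<open>fermat_little_int\<close> and to polynomials in \<open>gr_elem_frobenius\<close>.\<close>

lemma prime_dvd_sum_power_diff:
  fixes f :: "'b \<Rightarrow> 'a :: comm_ring_1"
  assumes "prime q"
  shows "of_nat q dvd (\<Sum>i\<in>A. f i) ^ q - (\<Sum>i\<in>A. f i ^ q)"
proof (induction A rule: infinite_finite_induct)
  case (insert a A)
  have "of_nat q dvd ((f a + (\<Sum>i\<in>A. f i)) ^ q - (f a ^ q + (\<Sum>i\<in>A. f i) ^ q))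
      + ((\<Sum>i\<in>A. f i) ^ q - (\<Sum>i\<in>A. f i ^ q))"
    by (intro dvd_add prime_dvd_add_power_diff assms insert.IH)
  then show ?case
    using insert.hyps by (simp add: algebra_simps)
qed (use assms in \<open>auto simp: power_0_left\<close>)

lemma of_int_dvd_of_int: "a dvd b \<Longrightarrow> (of_int a :: 'a :: comm_ring_1) dvd of_int b"
  by (metis dvd_def of_int_mult)

lemma dvd_power_diff:
  fixes x y :: "'a :: comm_ring_1"
  assumes "d dvd x - y"
  shows "d dvd x ^ n - y ^ n"
proof (induction n)
  case (Suc n)
  have "x ^ Suc n - y ^ Suc n = (x - y) * x ^ n + y * (x ^ n - y ^ n)"
    by (simp add: algebra_simps)
  with Suc assms show ?case by (auto intro: dvd_add)
qed simp

lemma dvd_mult_diff: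
  fixes x y :: "'a :: comm_ring_1"
  assumes "d dvd x - y" "d dvd u - v"
  shows "d dvd x * u - y * v"
proof -
  have "x * u - y * v = (x - y) * u + y * (u - v)"
    by (simp add: algebra_simps)
  with assms show ?thesis by (auto intro: dvd_add)
qed

lemma dvd_diff_trans:
  fixes x y z :: "'a :: comm_ring_1"
  assumes "d dvd x - y" "d dvd y - z"
  shows "d dvd x - z"
  using dvd_add[OF assms] by simp

lemma dvd_diff_sym:
  fixes x y :: "'a :: comm_ring_1"
  shows "d dvd x - y \<longleftrightarrow> d dvd y - x"
  by (metis dvd_minus_iff minus_diff_eq)

subsection \<open>Arithmetic of Eisenstein integers\<close>

lemma of_nat_eis: "of_nat n = Eis (int n) 0"
  using of_int_eis[of "int n"] by simp

lemma Eis_0: "0 = Eis 0 0" and Eis_1: "1 = Eis 1 0"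
  using of_int_eis[of 0] of_int_eis[of 1] by simp_all

lemma Eis_eq: "Eis a b = of_int a + of_int b * eis_omega"
  by (simp add: of_int_eis eis_omega_def Eis_times Eis_plus)

lemma of_int_dvd_Eis_iff: "of_int n dvd Eis a b \<longleftrightarrow> n dvd a \<and> n dvd b"
proof
  assume "of_int n dvd Eis a b"
  then obtain c where "Eis a b = of_int n * c" by (auto simp: dvd_def)
  then show "n dvd a \<and> n dvd b"
    by (cases c) (auto simp: of_int_eis Eis_times)
next
  assume "n dvd a \<and> n dvd b"
  then obtain c d where "a = n * c" "b = n * d" by (auto simp: dvd_def)
  then have "Eis a b = of_int n * Eis c d" by (simp add: of_int_eis Eis_times)
  then show "of_int n dvd Eis a b" by simp
qed

lemma of_int_dvd_of_int_eis_iff [simp]: "(of_int m :: eisenstein) dvd of_int n \<longleftrightarrow> m dvd n"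
  by (simp add: of_int_eis[of n] of_int_dvd_Eis_iff)

lemma eis_omega_square: "eis_omega\<^sup>2 = Eis (- 1) (- 1)"
  by (simp add: power2_eq_square eis_omega_def Eis_times)

lemma eis_omega_cube: "eis_omega ^ 3 = 1"
  by (simp add: power3_eq_cube eis_omega_def Eis_times Eis_1)

lemma cube_root_of_unity_cube: "\<zeta> \<in> {1, eis_omega, eis_omega\<^sup>2} \<Longrightarrow> \<zeta> ^ 3 = 1"
  by (auto simp: eis_omega_cube power2_eq_square power_mult_distrib)

lemma eis_norm_mult: "eis_norm (x * y) = eis_norm x * eis_norm y"
  by (cases x; cases y) (simp add: Eis_times eis_norm_Eis power2_eq_square algebra_simps)

lemma eis_norm_dvd: "x dvd y \<Longrightarrow> eis_norm x dvd eis_norm y"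
  by (auto simp: dvd_def eis_norm_mult)

lemma eis_norm_of_int: "eis_norm (of_int n) = n\<^sup>2"
  by (simp add: of_int_eis eis_norm_Eis)

lemma eis_norm_of_nat: "eis_norm (of_nat n) = (int n)\<^sup>2"
  using eis_norm_of_int[of "int n"] by simp

text \<open>Completing the square; this gives nonnegativity of the norm and the bound that singles
  out units.\<close>

lemma four_eis_norm: "4 * eis_norm (Eis a b) = (2 * a - b)\<^sup>2 + 3 * b\<^sup>2"
  by (simp add: eis_norm_Eis power2_eq_square algebra_simps)

lemma eis_norm_nonneg: "eis_norm x \<ge> 0"
proof (cases x)
  case (1 a b)
  have "4 * eis_norm x \<ge> 0" unfolding 1 four_eis_norm by simp
  then show ?thesis by simp
qed

lemma eis_norm_eq_mult_conj: "of_int (eis_norm (Eis a b)) = Eis a b * Eis (a - b) (- b)"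
  by (simp add: of_int_eis eis_norm_Eis Eis_times power2_eq_square algebra_simps)

lemma dvd_of_int_eis_norm: "x dvd of_int (eis_norm x)"
  by (cases x) (simp add: eis_norm_eq_mult_conj)

text \<open>Among the six units only 1 and -1 have an \<omega>-coordinate divisible by 3. This
  identifies unit cofactors in \<open>primary_prime_cases\<close> and
  \<open>jacobi_eq\<close>.\<close>

lemma eis_norm_eq_1_cases:
  assumes "eis_norm (Eis c d) = 1" "3 dvd d"
  shows "d = 0 \<and> (c = 1 \<or> c = -1)"
proof -
  have 1: "(2 * c - d)\<^sup>2 + 3 * d\<^sup>2 = 4" using four_eis_norm[of c d] assms by simp
  have "d = 0"
  proof (rule ccontr)
    assume "d \<noteq> 0"
    then have "3 \<le> \<bar>d\<bar>" using assms(2) by (auto elim!: dvdE)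
    then have "3\<^sup>2 \<le> \<bar>d\<bar>\<^sup>2" by (intro power_mono) auto
    moreover have "(2 * c - d)\<^sup>2 \<ge> 0" by simp
    ultimately show False using 1 by simp
  qed
  with 1 have "c\<^sup>2 = 1" by (simp add: power_mult_distrib)
  with \<open>d = 0\<close> show ?thesis by (simp add: power2_eq_1_iff)
qed

lemma eis_norm_prime_elem_ne_1:
  assumes "prime_elem \<pi>" shows "eis_norm \<pi> \<noteq> 1"
proof
  assume "eis_norm \<pi> = 1"
  then have "\<pi> dvd 1" using dvd_of_int_eis_norm[of \<pi>] by simp
  then show False using assms by (simp add: prime_elem_def)
qed

lemma primary_norm_mod: "primary \<pi> \<Longrightarrow> eis_norm \<pi> mod 3 = 1"
proof (cases \<pi>)
  case (1 a b)
  assume "primary \<pi>"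
  then have "a mod 3 = 2" "b mod 3 = 0" by (simp_all add: 1 primary_Eis)
  then have "a = 3 * (a div 3) + 2" "b = 3 * (b div 3)" by presburger+
  then obtain k l where "a = 3 * k + 2" "b = 3 * l" by blast
  then have "eis_norm \<pi> = 1 + 3 * (3 * k\<^sup>2 + 4 * k + 1 - (3 * k + 2) * l + 3 * l\<^sup>2)"
    by (simp add: 1 eis_norm_Eis power2_eq_square algebra_simps)
  then show ?thesis by presburger
qed

lemma prime_elem_dvd_of_nat_obtains_prime:
  assumes "prime_elem (\<pi> :: eisenstein)" "\<pi> dvd of_nat n" "n > 0"
  obtains p where "prime p" "\<pi> dvd of_nat p"
  using assms(2,3)
proof (induction n arbitrary: thesis rule: less_induct)
  case (less n)
  have "n \<noteq> 1" using less.prems assms(1) by (auto simp: prime_elem_def)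
  then obtain p where p: "prime p" "p dvd n" by (meson prime_factor_nat)
  then obtain m where m: "n = p * m" by (auto simp: dvd_def)
  then have "\<pi> dvd of_nat p \<or> \<pi> dvd of_nat m"
    using assms(1) less.prems by (simp add: prime_elem_dvd_mult_iff)
  moreover have "m < n" "m > 0" using m less.prems p prime_gt_1_nat[of p] by auto
  ultimately show ?case using less p by blast
qed

text \<open>Here g is a primitive root. Each use takes an exponent m with 0 < m < p - 1 and
  concludes that \<open>g ^ m\<close> is not 1 modulo p.\<close>

lemma prime_primitive_root_power:
  assumes "prime (p :: nat)"
  obtains g where "\<not> p dvd g" "\<And>m. [g ^ m = 1] (mod p) \<Longrightarrow> p - 1 dvd m"
proof -
  obtain g where g: "residue_primroot p g"
    using prime_primitive_root_exists[OF prime_gt_1_nat assms] assms by blast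
  have "coprime p g" "ord p g = p - 1"
    using g assms by (auto simp: residue_primroot_def totient_prime)
  then show ?thesis
    using that[of g] assms by (metis coprime_absorb_left ord_divides prime_nat_iff not_prime_unit)
qed

subsection \<open>The cubic residue character\<close>

lemma Eis_omega_square: "(Eis 0 1)\<^sup>2 = Eis (- 1) (- 1)"
  using eis_omega_square by (simp add: eis_omega_def)

lemma cube_minus_1_factors: "x ^ 3 - 1 = (x - 1) * (x - eis_omega) * (x - eis_omega\<^sup>2)"
  by (cases x)
    (simp add: Eis_omega_square eis_omega_def Eis_1 Eis_minus Eis_times power3_eq_cube algebra_simps)

lemma roots_of_unity_mult_closed:
  assumes "z \<in> {1, eis_omega, eis_omega\<^sup>2}" "w \<in> {1, eis_omega, eis_omega\<^sup>2}"
  shows "z * w \<in> {1, eis_omega, eis_omega\<^sup>2}"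
  using assms unfolding eis_omega_def Eis_omega_square Eis_1 by (auto simp: Eis_times)

section \<open>Frobenius congruences in D and the classification of primary primes\<close>

lemma fermat_little_int:
  assumes "prime p"
  shows "int p dvd a ^ p - a"
proof -
  have p: "p > 0" using assms prime_gt_0_nat by blast
  define n where "n = nat (a mod int p)"
  have n: "int p dvd a - int n" using p by (simp add: n_def mod_eq_dvd_iff[symmetric])
  have "int p dvd (int n) ^ p - int n"
    using prime_dvd_sum_power_diff[OF assms, of "\<lambda>_. 1 :: int" "{..<n}"] by simp
  moreover have "int p dvd a ^ p - int n ^ p" using n by (rule dvd_power_diff)
  ultimately have "int p dvd a ^ p - int n" by (rule dvd_diff_trans[rotated])
  then show ?thesis using n dvd_diff_sym dvd_diff_trans by metis
qed

text \<open>Modulo p the p-th power is additive and fixes integers, so it only acts on \<omega>; the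
  result depends on p modulo 3 alone.\<close>

lemma Eis_power_prime_cong:
  assumes "prime p"
  shows "of_nat p dvd Eis a b ^ p - (of_int a + of_int b * eis_omega ^ p)"
proof -
  have F: "of_nat p dvd (of_int c :: eisenstein) ^ p - of_int c" for c
    using of_int_dvd_of_int[OF fermat_little_int[OF assms, of c], where 'a = eisenstein] by simp
  have "of_nat p dvd (of_int b ^ p * eis_omega ^ p - of_int b * eis_omega ^ p)"
    using F[of b] by (metis dvd_mult2 left_diff_distrib)
  with F[of a] have "of_nat p dvd (of_int a ^ p - of_int a)
      + (of_int b ^ p * eis_omega ^ p - of_int b * eis_omega ^ p)"
    by (rule dvd_add)
  then have "of_nat p dvd of_int a ^ p + (of_int b * eis_omega) ^ p
      - (of_int a + of_int b * eis_omega ^ p)"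
    by (simp add: power_mult_distrib algebra_simps)
  with prime_dvd_add_power_diff[OF assms, of "of_int a" "of_int b * eis_omega"]
  show ?thesis unfolding Eis_eq by (rule dvd_diff_trans)
qed

lemma eis_omega_power_mod: "eis_omega ^ n = eis_omega ^ (n mod 3)"
proof -
  have "eis_omega ^ n = eis_omega ^ (3 * (n div 3) + n mod 3)" by simp
  then show ?thesis by (simp only: power_add power_mult eis_omega_cube power_one mult_1)
qed

text \<open>With k = (p - 1) / 3, the integer \<open>g ^ k\<close> is a cube root of unity modulo p.
  If p were prime in D, it would be congruent to 1, \<omega> or the square of \<omega>, and none of
  these is possible.\<close>

lemma prime_1_mod_3_not_prime_elem:
  assumes "prime p" "p mod 3 = 1"
  shows "\<not> prime_elem (of_nat p :: eisenstein)"
proof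
  assume P: "prime_elem (of_nat p :: eisenstein)"
  obtain g where g: "\<not> p dvd g" "\<And>m. [g ^ m = 1] (mod p) \<Longrightarrow> p - 1 dvd m"
    using prime_primitive_root_power[OF assms(1)] by blast
  define k where "k = (p - 1) div 3"
  have p1: "p > 1" using assms(1) prime_gt_1_nat by blast
  have k: "p = 3 * k + 1" using assms(2) p1 unfolding k_def by presburger
  then have "k > 0" using p1 by simp
  let ?x = "Eis (int (g ^ k)) 0"
  have x: "?x = of_nat (g ^ k)" by (simp add: of_nat_eis)
  have "[g ^ (p - 1) = 1] (mod p)" using fermat_theorem assms(1) g(1) by blast
  then have "int p dvd int (g ^ (p - 1)) - 1"
    by (simp add: cong_iff_dvd_diff flip: cong_int_iff)
  then have "of_nat p dvd (of_nat (g ^ (p - 1)) - 1 :: eisenstein)"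
    by (auto dest: of_int_dvd_of_int[where 'a = eisenstein])
  also have "of_nat (g ^ (p - 1)) - 1 = ?x ^ 3 - 1"
    unfolding x by (simp add: k mult.commute flip: power_mult)
  also have "\<dots> = (?x - 1) * (?x - eis_omega) * (?x - eis_omega\<^sup>2)"
    by (rule cube_minus_1_factors)
  finally have "of_nat p dvd ?x - 1 \<or> of_nat p dvd ?x - eis_omega \<or> of_nat p dvd ?x - eis_omega\<^sup>2"
    using P by (auto simp: prime_elem_dvd_mult_iff)
  \<comment> \<open>The \<omega>-coordinates of the last two differences are -1 and 1, so
    divisibility by p would give p dvd 1.\<close>
  then have "int p dvd int (g ^ k) - 1 \<or> int p dvd 1"
    using of_int_dvd_Eis_iff[of "int p"]
    unfolding eis_omega_def Eis_omega_square Eis_1 by (auto simp: Eis_minus)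
  then have "[g ^ k = 1] (mod p)"
    using p1 by (auto simp: cong_iff_dvd_diff simp flip: cong_int_iff)
  then have "p - 1 dvd k" by (rule g)
  then show False using \<open>k > 0\<close> k by (auto dest: dvd_imp_le)
qed

text \<open>\<pi> divides a rational prime p, so its norm divides the square of p and equals p or
  that square. In the second case \<pi> is p times a unit; being primary forces the unit to be 1 or
  -1, and for -1 the prime p would be 1 modulo 3, hence not prime in D.\<close>

lemma primary_prime_cases:
  assumes "prime_elem \<pi>" "primary \<pi>"
  obtains (split) p where "prime p" "p mod 3 = 1" "eis_norm \<pi> = int p"
    | (inert) q where "prime q" "q mod 3 = 2" "\<pi> = of_nat q"
proof -
  define n where "n = nat (eis_norm \<pi>)"
  have n: "eis_norm \<pi> = int n" by (simp add: n_def eis_norm_nonneg)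
  have N1: "eis_norm \<pi> mod 3 = 1" using assms(2) by (rule primary_norm_mod)
  then have "n > 0" using n by (cases n) auto
  moreover have "\<pi> dvd of_nat n" using dvd_of_int_eis_norm[of \<pi>] n by simp
  ultimately obtain p where p: "prime p" "\<pi> dvd of_nat p"
    using prime_elem_dvd_of_nat_obtains_prime assms(1) by blast
  then obtain \<beta> where \<beta>: "of_nat p = \<pi> * \<beta>" by (auto simp: dvd_def)
  have N: "eis_norm \<pi> * eis_norm \<beta> = int p ^ 2"
    by (metis \<beta> eis_norm_mult eis_norm_of_nat)
  then have "int n dvd int (p ^ 2)" using n by (metis dvd_triv_left of_nat_power)
  then have "n dvd p ^ 2" by presburger
  then obtain i where i: "i \<le> 2" "n = p ^ i" using divides_primepow_nat[OF p(1)] by blast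
  have "n \<noteq> 1" using eis_norm_prime_elem_ne_1[OF assms(1)] n by simp
  then have "i \<noteq> 0" using i by auto
  then consider "i = 1" | "i = 2" using i by linarith
  then show thesis
  proof cases
    case 1
    then have "int p mod 3 = 1" using n i N1 by simp
    then have "p mod 3 = 1" by presburger
    then show thesis using split[of p] p(1) n i 1 by simp
  next
    case 2
    have p0: "p > 0" using p(1) prime_gt_0_nat by blast
    obtain c d where cd: "\<beta> = Eis c d" by (cases \<beta>)
    \<comment> \<open>The conjugate of \<beta>, which is its inverse once the norm of \<beta> is
      known to be 1.\<close>
    let ?u = "Eis (c - d) (- d)"
    have "eis_norm \<beta> = 1" using N n i 2 p0 by simp
    then have u1: "\<beta> * ?u = 1" "eis_norm ?u = 1"
      using eis_norm_eq_mult_conj[of c d] cd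
      by (simp_all add: eis_norm_Eis power2_eq_square algebra_simps)
    have "\<pi> = \<pi> * (\<beta> * ?u)" by (simp add: u1)
    also have "\<dots> = of_nat p * ?u" by (simp add: \<beta> mult.assoc)
    finally have \<pi>: "\<pi> = Eis (int p * (c - d)) (int p * (- d))" by (simp add: of_nat_eis Eis_times)
    then have r: "(int p * (c - d)) mod 3 = 2" "(int p * (- d)) mod 3 = 0"
      using assms(2) by (simp_all add: primary_Eis)
    then have "\<not> 3 dvd int p" by (metis dvd_mult2 dvd_imp_mod_0 zero_neq_numeral)
    then have "3 dvd - d"
      using r(2) prime_dvd_mult_iff[of "3 :: int" "int p" "- d"] by (auto simp: mod_eq_0_iff_dvd)
    then have u: "- d = 0 \<and> (c - d = 1 \<or> c - d = - 1)" using u1(2) eis_norm_eq_1_cases by blast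
    show thesis
    proof (cases "c - d = 1")
      case True
      then have "\<pi> = of_nat p" "int p mod 3 = 2" using u r \<pi> by (simp_all add: of_nat_eis)
      then have "p mod 3 = 2" by presburger
      then show thesis using inert[of p] p(1) \<open>\<pi> = of_nat p\<close> by blast
    next
      case False
      then have "c - d = - 1" using u by simp
      then have *: "\<pi> = - of_nat p" "(- int p) mod 3 = 2"
        using u r \<pi> of_int_eis[of "- int p"] by (simp_all)
      then have "p mod 3 = 1" by presburger
      moreover have "prime_elem (of_nat p :: eisenstein)"
        using assms(1) * by (auto simp: prime_elem_def)
      ultimately show thesis using prime_1_mod_3_not_prime_elem p(1) by blast
    qed
  qed
qed

text \<open>Fermat's theorem in \<open>D/\<pi>\<close>, obtained from the action of the Frobenius map on \<open>a + b \<omega>\<close>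
  without counting residues.\<close>

lemma primary_prime_dvd_power_norm_diff:
  assumes "prime_elem \<pi>" "primary \<pi>"
  shows "\<pi> dvd \<alpha> ^ nat (eis_norm \<pi>) - \<alpha>"
proof -
  obtain a b where ab: "\<alpha> = Eis a b" by (cases \<alpha>)
  show ?thesis using assms
  proof (cases rule: primary_prime_cases)
    case (split p)
    have "of_nat p dvd Eis a b ^ p - Eis a b"
      using Eis_power_prime_cong[OF split(1), of a b] eis_omega_power_mod[of p] split(2)
      by (simp add: Eis_eq)
    moreover have "\<pi> dvd of_nat p" using dvd_of_int_eis_norm[of \<pi>] split(3) by simp
    ultimately show ?thesis using split(3) ab by (auto intro: dvd_trans)
  next
    case (inert q)
    \<comment> \<open>For q congruent to 2 modulo 3 the q-th power acts as complex conjugation, so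
      applying it twice gives the identity modulo q.\<close>
    have Q: "of_nat q dvd Eis c d ^ q - Eis (c - d) (- d)" for c d
      using Eis_power_prime_cong[OF inert(1), of c d] eis_omega_power_mod[of q] inert(2)
      by (simp add: Eis_eq[of "c - d"] eis_omega_square Eis_eq[of "- 1"] algebra_simps)
    have "of_nat q dvd (Eis a b ^ q) ^ q - Eis (a - b) (- b) ^ q"
      by (intro dvd_power_diff Q)
    moreover have "of_nat q dvd Eis (a - b) (- b) ^ q - Eis a b"
      using Q[of "a - b" "- b"] by simp
    ultimately have "of_nat q dvd (Eis a b ^ q) ^ q - Eis a b" by (rule dvd_diff_trans)
    moreover have "nat (eis_norm \<pi>) = q * q"
      by (simp add: inert eis_norm_of_nat power2_eq_square nat_mult_distrib)
    ultimately show ?thesis using ab inert by (simp add: power_mult)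
  qed
qed

section \<open>Values, congruence invariance and multiplicativity of the cubic character\<close>

definition cubic_exp :: "eisenstein \<Rightarrow> nat" where
  "cubic_exp \<pi> = nat ((eis_norm \<pi> - 1) div 3)"

lemma cubic_exp:
  assumes "primary \<pi>"
  shows "nat (eis_norm \<pi>) = 3 * cubic_exp \<pi> + 1"
proof -
  have "eis_norm \<pi> = 3 * ((eis_norm \<pi> - 1) div 3) + 1"
    using primary_norm_mod[OF assms] by presburger
  moreover have "(eis_norm \<pi> - 1) div 3 \<ge> 0"
    using primary_norm_mod[OF assms] eis_norm_nonneg[of \<pi>] by presburger
  ultimately show ?thesis unfolding cubic_exp_def by linarith
qed

text \<open>Two distinct cube roots of unity differ by an element of norm 3, while the norm of \<pi>
  is 1 modulo 3 and not 1, hence at least 4.\<close>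

lemma primary_prime_roots_of_unity_incongruent:
  assumes "prime_elem \<pi>" "primary \<pi>"
    and "\<zeta> \<in> {1, eis_omega, eis_omega\<^sup>2}" "\<zeta>' \<in> {1, eis_omega, eis_omega\<^sup>2}"
    and "\<pi> dvd \<zeta> - \<zeta>'"
  shows "\<zeta> = \<zeta>'"
proof (rule ccontr)
  assume "\<zeta> \<noteq> \<zeta>'"
  then have "eis_norm (\<zeta> - \<zeta>') = 3"
    using assms(3,4) unfolding eis_omega_def Eis_omega_square Eis_1
    by (auto simp: Eis_minus eis_norm_Eis)
  then have "eis_norm \<pi> dvd 3" using assms(5) eis_norm_dvd by metis
  then have "eis_norm \<pi> \<le> 3" by (rule zdvd_imp_le) simp
  moreover have "eis_norm \<pi> mod 3 = 1" "eis_norm \<pi> \<noteq> 1" "eis_norm \<pi> \<ge> 0"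
    using assms primary_norm_mod eis_norm_prime_elem_ne_1 eis_norm_nonneg by blast+
  ultimately show False by presburger
qed

lemma cubic_char_eqI:
  assumes "prime_elem \<pi>" "primary \<pi>" "\<not> \<pi> dvd \<alpha>"
    and "\<zeta> \<in> {1, eis_omega, eis_omega\<^sup>2}" "\<pi> dvd \<alpha> ^ cubic_exp \<pi> - \<zeta>"
  shows "cubic_char \<pi> \<alpha> = \<zeta>"
proof -
  have "(THE \<zeta>. \<zeta> \<in> {1, eis_omega, eis_omega\<^sup>2} \<and> \<pi> dvd \<alpha> ^ cubic_exp \<pi> - \<zeta>) = \<zeta>"
  proof (rule the_equality)
    fix \<zeta>' assume *: "\<zeta>' \<in> {1, eis_omega, eis_omega\<^sup>2} \<and> \<pi> dvd \<alpha> ^ cubic_exp \<pi> - \<zeta>'"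
    then have "\<pi> dvd \<zeta>' - \<zeta>" using assms(5) dvd_diff_sym dvd_diff_trans by metis
    with * show "\<zeta>' = \<zeta>"
      using primary_prime_roots_of_unity_incongruent assms(1,2,4) by blast
  qed (use assms in simp)
  then show ?thesis using assms(3) by (simp add: cubic_char_def eis_cong_def cubic_exp_def)
qed

text \<open>By Fermat's theorem in D/\<pi> the power of \<alpha> is a root of
  \<open>x ^ 3 - 1\<close>, which splits into linear factors over D; primality of \<pi> selects one
  of them.\<close>

lemma cubic_char_spec:
  assumes "prime_elem \<pi>" "primary \<pi>" "\<not> \<pi> dvd \<alpha>"
  shows "cubic_char \<pi> \<alpha> \<in> {1, eis_omega, eis_omega\<^sup>2}"
    and "\<pi> dvd \<alpha> ^ cubic_exp \<pi> - cubic_char \<pi> \<alpha>"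
proof -
  define x where "x = \<alpha> ^ cubic_exp \<pi>"
  have "\<pi> dvd \<alpha> * (x ^ 3 - 1)"
    using primary_prime_dvd_power_norm_diff[OF assms(1,2), of \<alpha>] cubic_exp[OF assms(2)]
    by (simp add: x_def algebra_simps flip: power_mult)
  then have "\<pi> dvd x ^ 3 - 1" using assms by (simp add: prime_elem_dvd_mult_iff)
  also have "x ^ 3 - 1 = (x - 1) * (x - eis_omega) * (x - eis_omega\<^sup>2)"
    by (rule cube_minus_1_factors)
  finally have "\<exists>\<zeta> \<in> {1, eis_omega, eis_omega\<^sup>2}. \<pi> dvd x - \<zeta>"
    using assms(1) by (auto simp: prime_elem_dvd_mult_iff)
  then obtain \<zeta> where \<zeta>: "\<zeta> \<in> {1, eis_omega, eis_omega\<^sup>2}" "\<pi> dvd x - \<zeta>" by blast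
  then have "cubic_char \<pi> \<alpha> = \<zeta>" using assms cubic_char_eqI unfolding x_def by blast
  with \<zeta> show "cubic_char \<pi> \<alpha> \<in> {1, eis_omega, eis_omega\<^sup>2}"
    "\<pi> dvd \<alpha> ^ cubic_exp \<pi> - cubic_char \<pi> \<alpha>" unfolding x_def by simp_all
qed

lemma cubic_char_eq_0 [simp]: "\<pi> dvd \<alpha> \<Longrightarrow> cubic_char \<pi> \<alpha> = 0"
  by (simp add: cubic_char_def)

lemma cubic_char_cube:
  assumes "prime_elem \<pi>" "primary \<pi>" "\<not> \<pi> dvd \<alpha>"
  shows "cubic_char \<pi> \<alpha> ^ 3 = 1"
  using cubic_char_spec(1)[OF assms] by (rule cube_root_of_unity_cube)

lemma cubic_char_cong:
  assumes "prime_elem \<pi>" "primary \<pi>" "\<pi> dvd \<alpha> - \<beta>"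
  shows "cubic_char \<pi> \<alpha> = cubic_char \<pi> \<beta>"
proof (cases "\<pi> dvd \<alpha>")
  case True
  then have "\<pi> dvd \<beta>" using dvd_diff[OF True assms(3)] by simp
  with True show ?thesis by simp
next
  case False
  then have \<beta>: "\<not> \<pi> dvd \<beta>" using dvd_add[OF assms(3), of \<beta>] by auto
  have "\<pi> dvd \<alpha> ^ cubic_exp \<pi> - \<beta> ^ cubic_exp \<pi>" using assms(3) by (rule dvd_power_diff)
  then have "\<pi> dvd \<alpha> ^ cubic_exp \<pi> - cubic_char \<pi> \<beta>"
    using cubic_char_spec(2)[OF assms(1,2) \<beta>] by (rule dvd_diff_trans)
  then show ?thesis using assms False cubic_char_spec(1)[OF assms(1,2) \<beta>] cubic_char_eqI by blast
qed

lemma cubic_char_mult: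
  assumes "prime_elem \<pi>" "primary \<pi>"
  shows "cubic_char \<pi> (\<alpha> * \<beta>) = cubic_char \<pi> \<alpha> * cubic_char \<pi> \<beta>"
proof (cases "\<pi> dvd \<alpha> \<or> \<pi> dvd \<beta>")
  case True
  then show ?thesis by auto
next
  case False
  have "cubic_char \<pi> \<alpha> * cubic_char \<pi> \<beta> \<in> {1, eis_omega, eis_omega\<^sup>2}"
    using cubic_char_spec(1)[OF assms, of \<alpha>] cubic_char_spec(1)[OF assms, of \<beta>] False
    by (intro roots_of_unity_mult_closed) auto
  moreover have "\<pi> dvd (\<alpha> * \<beta>) ^ cubic_exp \<pi> - cubic_char \<pi> \<alpha> * cubic_char \<pi> \<beta>"
    unfolding power_mult_distrib using False by (intro dvd_mult_diff cubic_char_spec assms) auto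
  moreover have "\<not> \<pi> dvd \<alpha> * \<beta>" using False assms(1) by (simp add: prime_elem_dvd_mult_iff)
  ultimately show ?thesis using assms cubic_char_eqI by blast
qed

subsection \<open>The group ring of the integers modulo p\<close>

text \<open>Functions on the integers modulo p are encoded as periodic functions on all integers, so
  arguments can be shifted and scaled without reduction.\<close>

definition residues_per :: "nat \<Rightarrow> (int \<Rightarrow> 'a) \<Rightarrow> bool" where
  "residues_per p f \<longleftrightarrow> (\<forall>t. f (t mod int p) = f t)"

lemma residues_perD: "residues_per p f \<Longrightarrow> a mod int p = b mod int p \<Longrightarrow> f a = f b"
  by (metis residues_per_def)

lemma sum_residues_shift:
  assumes "p > 0" "residues_per p f"
  shows "(\<Sum>t\<in>{0..<int p}. f (t + c)) = (\<Sum>t\<in>{0..<int p}. f t)"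
  by (rule sum.reindex_bij_witness[of _ "\<lambda>t. (t - c) mod int p" "\<lambda>t. (t + c) mod int p"])
    (use assms in \<open>auto simp: residues_per_def mod_simps\<close>)

lemma sum_residues_scale:
  assumes "p > 0" "residues_per p f" "(c * d) mod int p = 1 mod int p"
  shows "(\<Sum>t\<in>{0..<int p}. f (c * t)) = (\<Sum>t\<in>{0..<int p}. f t)"
proof -
  have *: "(c * (d * t)) mod int p = t mod int p" for t
    using assms(3) by (metis mod_mult_left_eq mult.assoc mult_1)
  have **: "(d * (c * t)) mod int p = t mod int p" for t
    using *[of t] by (simp add: mult.left_commute)
  show ?thesis
    by (rule sum.reindex_bij_witness[of _ "\<lambda>t. (d * t) mod int p" "\<lambda>t. (c * t) mod int p"])
      (use assms(1,2) in \<open>auto simp: residues_per_def mod_simps * **\<close>)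
qed

text \<open>Reducing the exponent makes the basis periodic in t and keeps every
  \<open>gr_elem\<close> of degree below p, so that its coefficients can be read off
  directly.\<close>

definition gr_basis :: "nat \<Rightarrow> int \<Rightarrow> 'a :: comm_ring_1 poly" where
  "gr_basis p t = monom 1 (nat (t mod int p))"

definition gr_elem :: "nat \<Rightarrow> (int \<Rightarrow> 'a :: comm_ring_1) \<Rightarrow> 'a poly" where
  "gr_elem p f = (\<Sum>t\<in>{0..<int p}. smult (f t) (gr_basis p t))"

text \<open>Congruence modulo the ideal generated by \<open>m\<close> and \<open>X\<^sup>p - 1\<close>; the case \<open>m = 0\<close> is
  equality in the group ring.\<close>

definition gr_cong :: "nat \<Rightarrow> 'a :: comm_ring_1 \<Rightarrow> 'a poly \<Rightarrow> 'a poly \<Rightarrow> bool" where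
  "gr_cong p m F H \<longleftrightarrow> (\<exists>U V. F - H = smult m U + (monom 1 p - 1) * V)"

lemma gr_congI: "F - H = smult m U + (monom 1 p - 1) * V \<Longrightarrow> gr_cong p m F H"
  by (auto simp: gr_cong_def)

lemma gr_cong_refl [simp]: "gr_cong p m F F"
  by (rule gr_congI[of _ _ _ 0 _ 0]) simp

lemma gr_cong_sym:
  assumes "gr_cong p m F H" shows "gr_cong p m H F"
proof -
  obtain U V where "F - H = smult m U + (monom 1 p - 1) * V"
    using assms by (auto simp: gr_cong_def)
  then have "H - F = smult m (- U) + (monom 1 p - 1) * (- V)"
    by (simp add: algebra_simps)
  then show ?thesis by (rule gr_congI)
qed

lemma gr_cong_add:
  assumes "gr_cong p m F H" "gr_cong p m F' H'"
  shows "gr_cong p m (F + F') (H + H')"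
proof -
  obtain U V U' V' where "F - H = smult m U + (monom 1 p - 1) * V"
    "F' - H' = smult m U' + (monom 1 p - 1) * V'"
    using assms by (auto simp: gr_cong_def)
  moreover have "(F + F') - (H + H') = (F - H) + (F' - H')" by simp
  ultimately have "(F + F') - (H + H') = smult m (U + U') + (monom 1 p - 1) * (V + V')"
    by (simp add: distrib_left smult_add_right)
  then show ?thesis by (rule gr_congI)
qed

lemma gr_cong_trans [trans]:
  assumes "gr_cong p m F H" "gr_cong p m H K"
  shows "gr_cong p m F K"
proof -
  obtain U V U' V' where "F - H = smult m U + (monom 1 p - 1) * V"
    "H - K = smult m U' + (monom 1 p - 1) * V'"
    using assms by (auto simp: gr_cong_def)
  moreover have "F - K = (F - H) + (H - K)" by simp
  ultimately have "F - K = smult m (U + U') + (monom 1 p - 1) * (V + V')"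
    by (simp add: distrib_left smult_add_right)
  then show ?thesis by (rule gr_congI)
qed

lemma gr_cong_mult_left:
  assumes "gr_cong p m F H"
  shows "gr_cong p m (K * F) (K * H)"
proof -
  obtain U V where *: "F - H = smult m U + (monom 1 p - 1) * V"
    using assms by (auto simp: gr_cong_def)
  have "K * F - K * H = K * (F - H)" by (simp add: algebra_simps)
  also have "\<dots> = smult m (K * U) + (monom 1 p - 1) * (K * V)"
    unfolding * by (simp add: algebra_simps)
  finally show ?thesis by (rule gr_congI)
qed

lemma gr_cong_mult:
  assumes "gr_cong p m F H" "gr_cong p m F' H'"
  shows "gr_cong p m (F * F') (H * H')"
proof -
  have "gr_cong p m (F' * F) (F' * H)" using assms(1) by (rule gr_cong_mult_left)
  also have "gr_cong p m (F' * H) (H * H')"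
    using gr_cong_mult_left[OF assms(2), of H] by (simp add: mult.commute)
  finally show ?thesis by (simp add: mult.commute)
qed

lemma gr_cong_smult: "gr_cong p m F H \<Longrightarrow> gr_cong p m (smult c F) (smult c H)"
  using gr_cong_mult_left[of p m F H "[:c:]"] by simp

lemma gr_cong_power: "gr_cong p m F H \<Longrightarrow> gr_cong p m (F ^ n) (H ^ n)"
  by (induction n) (auto intro: gr_cong_mult)

lemma gr_cong_sum:
  "(\<And>i. i \<in> A \<Longrightarrow> gr_cong p m (F i) (H i)) \<Longrightarrow> gr_cong p m (\<Sum>i\<in>A. F i) (\<Sum>i\<in>A. H i)"
  by (induction A rule: infinite_finite_induct) (auto intro: gr_cong_add)

lemma gr_basis_mult:
  assumes "p > 0"
  shows "gr_cong p m (gr_basis p s * gr_basis p t) (gr_basis p (s + t))"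
proof -
  define a b where ab: "a = nat (s mod int p)" "b = nat (t mod int p)"
  have lt: "a < p" "b < p" using assms by (auto simp: ab nat_less_iff)
  have "(s + t) mod int p = (int a + int b) mod int p"
    using assms by (simp add: ab mod_simps)
  then have st: "nat ((s + t) mod int p) = (a + b) mod p"
    by (metis nat_int of_nat_add zmod_int)
  show ?thesis
  proof (cases "a + b < p")
    case True
    then show ?thesis using st by (simp add: gr_basis_def mult_monom ab[symmetric])
  next
    case False
    then have "(a + b) mod p = a + b - p" using lt by (simp add: mod_if)
    \<comment> \<open>A sum of two reduced exponents wraps around at most once, so a single multiple
      of X^p - 1 corrects it.\<close>
    then have "gr_basis p s * gr_basis p t - gr_basis p (s + t)
        = smult m 0 + (monom 1 p - 1) * monom (1 :: 'a) (a + b - p)"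
      using st False
      by (simp add: gr_basis_def mult_monom ab[symmetric] left_diff_distrib)
    then show ?thesis by (rule gr_congI)
  qed
qed

lemma gr_basis_power:
  assumes "p > 0"
  shows "gr_cong p m (gr_basis p t ^ n) (gr_basis p (int n * t))"
proof (induction n)
  case (Suc n)
  have "gr_cong p m (gr_basis p t * gr_basis p t ^ n) (gr_basis p t * gr_basis p (int n * t))"
    by (rule gr_cong_mult_left[OF Suc])
  also have "gr_cong p m \<dots> (gr_basis p (t + int n * t))"
    by (rule gr_basis_mult[OF assms])
  finally show ?case by (simp add: algebra_simps)
qed (simp add: gr_basis_def)

lemma residues_per_gr_basis: "residues_per p (gr_basis p)"
  by (simp add: residues_per_def gr_basis_def)

lemma smult_gr_elem: "smult c (gr_elem p f) = gr_elem p (\<lambda>t. c * f t)"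
proof -
  have "smult c (\<Sum>t\<in>A. F t) = (\<Sum>t\<in>A. smult c (F t))" for A and F :: "int \<Rightarrow> 'a poly"
    by (induction A rule: infinite_finite_induct) (simp_all add: smult_add_right)
  then show ?thesis by (simp add: gr_elem_def)
qed

text \<open>The new coefficient function is the cyclic convolution of \<open>f\<close> and
  \<open>h\<close>, obtained by substituting c = a + b in the inner sum.\<close>

lemma gr_elem_mult:
  assumes p: "p > 0" and f: "residues_per p f" and h: "residues_per p h"
  shows "gr_cong p m (gr_elem p f * gr_elem p h)
    (gr_elem p (\<lambda>c. \<Sum>a\<in>{0..<int p}. f a * h (c - a)))"
proof -
  let ?R = "{0..<int p}"
  have "gr_elem p f * gr_elem p h
      = (\<Sum>a\<in>?R. \<Sum>b\<in>?R. smult (f a * h b) (gr_basis p a * gr_basis p b))"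
    by (simp add: gr_elem_def sum_product mult.commute)
  also have "gr_cong p m \<dots> (\<Sum>a\<in>?R. \<Sum>b\<in>?R. smult (f a * h b) (gr_basis p (a + b)))"
    by (intro gr_cong_sum gr_cong_smult gr_basis_mult p)
  also have "(\<Sum>a\<in>?R. \<Sum>b\<in>?R. smult (f a * h b) (gr_basis p (a + b)))
      = (\<Sum>a\<in>?R. \<Sum>c\<in>?R. smult (f a * h (c - a)) (gr_basis p c))"
  proof (rule sum.cong)
    fix a
    have "residues_per p (\<lambda>c. smult (f a * h (c - a)) (gr_basis p c))"
      using residues_perD[OF h] residues_per_gr_basis[of p]
      unfolding residues_per_def by (metis mod_diff_left_eq)
    from sum_residues_shift[OF p this, of a]
    show "(\<Sum>b\<in>?R. smult (f a * h b) (gr_basis p (a + b)))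
        = (\<Sum>c\<in>?R. smult (f a * h (c - a)) (gr_basis p c))"
      by (simp add: add.commute)
  qed simp
  also have "\<dots> = gr_elem p (\<lambda>c. \<Sum>a\<in>?R. f a * h (c - a))"
    unfolding gr_elem_def smult_sum by (rule sum.swap)
  finally show ?thesis .
qed

lemma coeff_gr_elem: "coeff (gr_elem p f) n = (if n < p then f (int n) else 0)"
proof -
  have "coeff (gr_elem p f) n = (\<Sum>t\<in>{0..<int p}. if t = int n then f t else 0)"
    unfolding gr_elem_def coeff_sum
    by (rule sum.cong) (auto simp: gr_basis_def)
  also have "\<dots> = (if n < p then f (int n) else 0)"
    by (subst sum.delta) auto
  finally show ?thesis .
qed

text \<open>Summing the coefficients over the progression \<open>c, c + p, c + 2 p, \<dots>\<close> kills every
  multiple of \<open>X\<^sup>p - 1\<close> by telescoping.\<close>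

lemma gr_elem_cong_dvd:
  assumes p: "p > 0" and f: "residues_per p f" and h: "residues_per p h"
    and "gr_cong p m (gr_elem p f) (gr_elem p h)"
  shows "m dvd f c - h c"
proof -
  obtain U V where UV: "gr_elem p f - gr_elem p h = smult m U + (monom 1 p - 1) * V"
    using assms(4) by (auto simp: gr_cong_def)
  define n where "n = nat (c mod int p)"
  have n: "n < p" "int n = c mod int p" using p by (auto simp: n_def nat_less_iff)
  have tel: "(\<Sum>k\<le>N. coeff ((monom 1 p - 1) * V) (n + k * p)) = - coeff V (n + N * p)" for N
  proof (induction N)
    case 0
    then show ?case using n by (simp add: left_diff_distrib coeff_monom_mult)
  next
    case (Suc N)
    then show ?case by (simp add: left_diff_distrib coeff_monom_mult)
  qed
  \<comment> \<open>Large enough for the coefficient of V left over by the telescoping to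
    vanish.\<close>
  define N where "N = Suc (degree V)"
  have "N \<le> N * p" using p by simp
  then have "degree V < n + N * p" using N_def by linarith
  then have "m * (\<Sum>k\<le>N. coeff U (n + k * p))
      = (\<Sum>k\<le>N. coeff (gr_elem p f - gr_elem p h) (n + k * p))"
    unfolding UV coeff_add sum.distrib tel by (simp add: coeff_eq_0 sum_distrib_left)
  also have "\<dots> = (\<Sum>k\<le>N. if k = 0 then f (int n) - h (int n) else 0)"
  proof (rule sum.cong)
    fix k
    show "coeff (gr_elem p f - gr_elem p h) (n + k * p) = (if k = 0 then f (int n) - h (int n) else 0)"
      using n by (cases k) (simp_all add: coeff_gr_elem)
  qed simp
  also have "\<dots> = f (int n) - h (int n)" by simp
  also have "\<dots> = f c - h c" using f h n(2) by (simp add: residues_per_def)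
  finally show ?thesis by (metis dvd_triv_left)
qed

text \<open>Modulo q the q-th power raises each coefficient to the power q and sends X^t to X^(q t).
  Renaming q t as t replaces the argument of \<open>f\<close> by r t, where r inverts q modulo
  p.\<close>

lemma gr_elem_frobenius:
  assumes p: "p > 0" and f: "residues_per p f"
    and q: "prime q" and inv: "(int q * r) mod int p = 1 mod int p"
  shows "gr_cong p (of_nat q) (gr_elem p f ^ q) (gr_elem p (\<lambda>t. f (r * t) ^ q))"
proof -
  let ?R = "{0..<int p}"
  obtain U where "gr_elem p f ^ q - (\<Sum>t\<in>?R. smult (f t) (gr_basis p t) ^ q) = of_nat q * U"
    using prime_dvd_sum_power_diff[OF q, of "\<lambda>t. smult (f t) (gr_basis p t)" ?R]
    unfolding gr_elem_def by (auto simp: dvd_def)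
  then have "gr_elem p f ^ q - (\<Sum>t\<in>?R. smult (f t) (gr_basis p t) ^ q)
      = smult (of_nat q) U + (monom 1 p - 1) * 0"
    by (simp add: of_nat_poly)
  then have "gr_cong p (of_nat q) (gr_elem p f ^ q) (\<Sum>t\<in>?R. smult (f t) (gr_basis p t) ^ q)"
    by (rule gr_congI)
  also have "gr_cong p (of_nat q) \<dots> (\<Sum>t\<in>?R. smult (f t ^ q) (gr_basis p (int q * t)))"
    unfolding smult_power by (intro gr_cong_sum gr_cong_smult gr_basis_power p)
  also have "(\<Sum>t\<in>?R. smult (f t ^ q) (gr_basis p (int q * t)))
      = (\<Sum>t\<in>?R. smult (f (r * (int q * t)) ^ q) (gr_basis p (int q * t)))"
  proof (rule sum.cong)
    fix t
    have "(r * (int q * t)) mod int p = t mod int p"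
      using inv by (metis mod_mult_left_eq mult.assoc mult.commute mult_1)
    then show "smult (f t ^ q) (gr_basis p (int q * t))
        = smult (f (r * (int q * t)) ^ q) (gr_basis p (int q * t))"
      using residues_perD[OF f] by metis
  qed simp
  also have "\<dots> = gr_elem p (\<lambda>t. f (r * t) ^ q)"
    unfolding gr_elem_def
  proof (rule sum_residues_scale[OF p _ inv])
    show "residues_per p (\<lambda>t. smult (f (r * t) ^ q) (gr_basis p t))"
      using residues_perD[OF f] residues_per_gr_basis[of p]
      unfolding residues_per_def by (metis mod_mult_right_eq)
  qed
  finally show ?thesis .
qed

subsection \<open>Jacobi sums of cubic characters\<close>

definition jacobi_sum :: "nat \<Rightarrow> (int \<Rightarrow> 'a :: comm_ring_1) \<Rightarrow> 'a" where
  "jacobi_sum p \<psi> = (\<Sum>a\<in>{0..<int p}. \<psi> a * \<psi> (1 - a))"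

text \<open>These axioms are abstract so that the square of a character is again an instance:
  results for \<open>\<chi>\<close> transfer to its square through
  \<open>square_character\<close>.\<close>

locale cubic_character =
  fixes p :: nat and \<chi> :: "int \<Rightarrow> eisenstein"
  assumes prime_p: "prime p" and p_mod_3: "p mod 3 = 1"
    and per: "residues_per p \<chi>"
    and mult: "\<chi> (a * b) = \<chi> a * \<chi> b"
    and zero: "int p dvd a \<Longrightarrow> \<chi> a = 0"
    and cube: "\<not> int p dvd a \<Longrightarrow> \<chi> a ^ 3 = 1"
    and nontrivial: "\<exists>u. \<not> int p dvd u \<and> \<chi> u \<noteq> 1"
begin

abbreviation "R \<equiv> {0..<int p}"
abbreviation "J \<equiv> jacobi_sum p \<chi>"
abbreviation "g \<equiv> gr_elem p \<chi>"
abbreviation "g2 \<equiv> gr_elem p (\<lambda>t. (\<chi> t)\<^sup>2)"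
text \<open>The element \<open>p - \<Sum>\<^sub>t X\<^sup>t\<close>.\<close>

abbreviation "trace_elem \<equiv> gr_elem p (\<lambda>c. if int p dvd c then of_nat p - 1 else - 1 :: eisenstein)"

lemma p_gt_1: "p > 1" and p_pos: "p > 0"
  using prime_p prime_gt_1_nat prime_gt_0_nat by blast+

lemma not_dvd_1: "\<not> int p dvd 1"
  using p_gt_1 by simp

lemma inverse_exists:
  assumes "\<not> int p dvd u"
  obtains v where "(u * v) mod int p = 1 mod int p"
proof -
  have "coprime u (int p)"
    using assms prime_p by (metis coprime_commute prime_imp_coprime prime_nat_int_transfer)
  then obtain v where "[u * v = 1] (mod int p)" using cong_solve_coprime_int by blast
  then show ?thesis using that by (auto simp: cong_def)
qed

lemma four: "\<chi> a ^ 4 = \<chi> a"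
  using power_add[of "\<chi> a" 3 1] by (cases "int p dvd a") (simp_all add: zero cube)

lemma one: "\<chi> 1 = 1"
proof -
  have "\<chi> 1 \<noteq> 0" using cube[OF not_dvd_1] by auto
  then show ?thesis using mult[of 1 1] by (metis mult_1 mult_cancel_left1)
qed

lemma minus_one_sq: "(\<chi> (- 1))\<^sup>2 = 1"
  using mult[of "- 1" "- 1"] one by (simp add: power2_eq_square)

lemma square_character: "cubic_character p (\<lambda>t. (\<chi> t)\<^sup>2)"
proof
  obtain u where u: "\<not> int p dvd u" "\<chi> u \<noteq> 1" using nontrivial by blast
  have "\<chi> u ^ 3 = (\<chi> u)\<^sup>2 * \<chi> u" by (simp add: power3_eq_cube power2_eq_square)
  then have "(\<chi> u)\<^sup>2 \<noteq> 1" using cube[OF u(1)] u(2) by auto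
  with u show "\<exists>u. \<not> int p dvd u \<and> (\<chi> u)\<^sup>2 \<noteq> 1" by blast
  show "((\<chi> a)\<^sup>2) ^ 3 = 1" if "\<not> int p dvd a" for a
    using cube[OF that] by (metis mult.commute power_mult power_one)
qed (use prime_p p_mod_3 per in \<open>auto simp: residues_per_def mult zero power_mult_distrib\<close>)

text \<open>Scaling by u permutes the residues and multiplies the sum by \<open>\<chi> u\<close>,
  which is not 1.\<close>

lemma sum_eq_0: "(\<Sum>t\<in>R. \<chi> t) = 0"
proof -
  obtain u where u: "\<not> int p dvd u" "\<chi> u \<noteq> 1" using nontrivial by blast
  obtain v where v: "(u * v) mod int p = 1 mod int p" using inverse_exists[OF u(1)] .
  have "\<chi> u * (\<Sum>t\<in>R. \<chi> t) = (\<Sum>t\<in>R. \<chi> (u * t))" by (simp add: mult sum_distrib_left)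
  also have "\<dots> = (\<Sum>t\<in>R. \<chi> t)" by (rule sum_residues_scale[OF p_pos per v])
  finally show ?thesis using u(2) by (metis mult_cancel_right1)
qed

lemma sum_sq_eq_0: "(\<Sum>t\<in>R. (\<chi> t)\<^sup>2) = 0"
  by (rule cubic_character.sum_eq_0[OF square_character])

lemma shift_dvd: "int p dvd c \<Longrightarrow> \<chi> (c - a) = \<chi> (- 1) * \<chi> a"
proof -
  assume "int p dvd c"
  then have "(c - a) mod int p = (- 1 * a) mod int p" by (auto elim!: dvdE simp: mod_eq_dvd_iff)
  then show ?thesis using residues_perD[OF per] mult by metis
qed

lemma R_dvd_iff: "a \<in> R \<Longrightarrow> int p dvd a \<longleftrightarrow> a = 0"
  by (auto simp: zdvd_not_zless dest: zdvd_imp_le)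

lemma sum_R_split: "(\<Sum>a\<in>R. if int p dvd a then x else y) = x + (of_nat p - 1) * (y :: eisenstein)"
proof -
  have R: "R = insert 0 {1..<int p}" using p_pos by auto
  have "(\<Sum>a\<in>{1..<int p}. if int p dvd a then x else y) = (\<Sum>a\<in>{1..<int p}. y)"
    by (rule sum.cong) (auto simp: R_dvd_iff)
  then show ?thesis using p_pos unfolding R by (simp add: of_nat_diff)
qed

text \<open>For c prime to p, substituting c a for a pulls out the square of
  \<open>\<chi> c\<close>. For p dividing c both sides vanish, the left one being a multiple of the
  sum of the squared character.\<close>

lemma conv_self: "(\<Sum>a\<in>R. \<chi> a * \<chi> (c - a)) = J * (\<chi> c)\<^sup>2"
proof (cases "int p dvd c")
  case True
  have "(\<Sum>a\<in>R. \<chi> a * \<chi> (c - a)) = \<chi> (- 1) * (\<Sum>a\<in>R. (\<chi> a)\<^sup>2)"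
    by (simp add: shift_dvd[OF True] sum_distrib_left power2_eq_square mult_ac)
  then show ?thesis using True by (simp add: sum_sq_eq_0 zero)
next
  case False
  then obtain d where d: "(c * d) mod int p = 1 mod int p" using inverse_exists by blast
  have "residues_per p (\<lambda>a. \<chi> a * \<chi> (c - a))"
    using residues_perD[OF per] unfolding residues_per_def by (metis mod_diff_right_eq mod_mod_trivial)
  from sum_residues_scale[OF p_pos this d]
  have "(\<Sum>a\<in>R. \<chi> a * \<chi> (c - a)) = (\<Sum>a\<in>R. \<chi> (c * a) * \<chi> (c * (1 - a)))"
    by (simp add: algebra_simps)
  also have "\<dots> = (\<Sum>a\<in>R. \<chi> a * \<chi> (1 - a) * (\<chi> c)\<^sup>2)"
    by (simp only: mult power2_eq_square mult_ac)
  also have "\<dots> = J * (\<chi> c)\<^sup>2"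
    by (simp add: jacobi_sum_def sum_distrib_right)
  finally show ?thesis .
qed

text \<open>The cube of \<open>\<chi>\<close> is 1 off the multiples of p. So for p dividing c the
  sum counts the nonzero residues, and scaling shows that it has one common value K at all other
  c.\<close>

lemma conv_square:
  "(\<Sum>a\<in>R. \<chi> a * (\<chi> (c - a))\<^sup>2) = (if int p dvd c then of_nat p - 1 else - 1)"
proof -
  define K where "K = (\<Sum>a\<in>R. \<chi> a * (\<chi> (1 - a))\<^sup>2)"
  have conv: "(\<Sum>a\<in>R. \<chi> a * (\<chi> (c - a))\<^sup>2) = (if int p dvd c then of_nat p - 1 else K)" for c
  proof (cases "int p dvd c")
    case True
    have "(\<Sum>a\<in>R. \<chi> a * (\<chi> (c - a))\<^sup>2) = (\<Sum>a\<in>R. \<chi> a ^ 3)"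
      by (simp add: shift_dvd[OF True] power_mult_distrib minus_one_sq flip: power_Suc)
    also have "\<dots> = (\<Sum>a\<in>R. if int p dvd a then 0 else 1)"
      by (rule sum.cong) (auto simp: cube zero)
    finally show ?thesis using True by (simp add: sum_R_split)
  next
    case False
    then obtain d where d: "(c * d) mod int p = 1 mod int p" using inverse_exists by blast
    have "residues_per p (\<lambda>a. \<chi> a * (\<chi> (c - a))\<^sup>2)"
      using residues_perD[OF per] unfolding residues_per_def by (metis mod_diff_right_eq mod_mod_trivial)
    from sum_residues_scale[OF p_pos this d]
    have "(\<Sum>a\<in>R. \<chi> a * (\<chi> (c - a))\<^sup>2) = (\<Sum>a\<in>R. \<chi> (c * a) * (\<chi> (c * (1 - a)))\<^sup>2)"
      by (simp add: algebra_simps)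
    also have "\<dots> = (\<Sum>a\<in>R. \<chi> c ^ 3 * (\<chi> a * (\<chi> (1 - a))\<^sup>2))"
      by (simp only: mult power2_eq_square power3_eq_cube mult_ac)
    also have "\<dots> = (\<chi> c ^ 3) * K"
      by (simp add: K_def sum_distrib_left)
    finally show ?thesis using False by (simp add: cube)
  qed
  \<comment> \<open>\<open>K\<close> is determined by the vanishing of the sum over all \<open>c\<close>.\<close>
  have "(\<Sum>c\<in>R. \<Sum>a\<in>R. \<chi> a * (\<chi> (c - a))\<^sup>2) = (\<Sum>a\<in>R. \<chi> a * (\<Sum>c\<in>R. (\<chi> (c + - a))\<^sup>2))"
    by (subst sum.swap) (simp add: sum_distrib_left)
  also have "\<dots> = (\<Sum>a\<in>R. \<chi> a * (\<Sum>c\<in>R. (\<chi> c)\<^sup>2))"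
    by (simp only: sum_residues_shift[OF p_pos cubic_character.per[OF square_character]])
  also have "\<dots> = 0" by (simp add: sum_sq_eq_0)
  finally have "(of_nat p - 1) + (of_nat p - 1) * K = 0" by (simp add: conv sum_R_split)
  then have "(of_nat p - 1) * (1 + K) = 0" by (simp add: algebra_simps)
  moreover have "of_nat p - 1 \<noteq> (0 :: eisenstein)"
    using p_gt_1 by (simp add: of_nat_eis Eis_1)
  ultimately have "K = - 1" by (simp add: add_eq_0_iff)
  then show ?thesis by (simp add: conv)
qed

text \<open>The coefficients of \<open>trace_elem\<close> are p at 0 minus 1 everywhere, and the
  constant part contributes the sum of \<open>\<chi>\<close>, which is 0. Hence
  \<open>trace_elem\<close> acts on \<open>g\<close> as multiplication by p.\<close>

lemma conv_trace:
  "(\<Sum>a\<in>R. (if int p dvd a then of_nat p - 1 else - 1) * \<chi> (c - a)) = of_nat p * \<chi> c"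
proof -
  have "(\<Sum>a\<in>R. (if int p dvd a then of_nat p - 1 else - 1) * \<chi> (c - a))
      = (\<Sum>a\<in>R. (if a = 0 then of_nat p * \<chi> c else 0) - \<chi> (c - a))"
    by (rule sum.cong) (auto simp: R_dvd_iff algebra_simps)
  also have "\<dots> = of_nat p * \<chi> c - (\<Sum>a\<in>R. \<chi> (c - a))"
    using p_pos by (simp add: sum_subtractf)
  also have "(\<Sum>a\<in>R. \<chi> (c - a)) = (\<Sum>a\<in>R. \<chi> (c + a))"
  proof -
    have "residues_per p (\<lambda>a. \<chi> (c + a))"
      using residues_perD[OF per] unfolding residues_per_def by (metis mod_add_right_eq)
    from sum_residues_scale[OF p_pos this, of "- 1" "- 1"] show ?thesis by simp
  qed
  also have "\<dots> = 0"
    using sum_residues_shift[OF p_pos per, of c] by (simp add: add.commute sum_eq_0)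
  finally show ?thesis by simp
qed

section \<open>Products and powers of the Gauss sum in the group ring\<close>

lemma per_sq: "residues_per p (\<lambda>t. (\<chi> t)\<^sup>2)"
  using per by (simp add: residues_per_def)

lemma per_trace: "residues_per p (\<lambda>c. if int p dvd c then x else y)"
  by (simp add: residues_per_def dvd_mod_iff)

text \<open>The modulus m stays free in the Gauss sum relations: they are used with m = 0 for exact
  identities and with m = 3 or m = q for congruences.\<close>

lemma gauss_square: "gr_cong p m (g * g) (smult J g2)"
  using gr_elem_mult[OF p_pos per per, of m] by (simp add: conv_self smult_gr_elem)

lemma gauss_square_sq: "gr_cong p m (g2 * g2) (smult (jacobi_sum p (\<lambda>t. (\<chi> t)\<^sup>2)) g)"
  using cubic_character.gauss_square[OF square_character, of m] by (simp add: four flip: power_mult)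

text \<open>Counterpart of the fact that a complex cubic Gauss sum times its conjugate is p. In the
  group ring p is replaced by \<open>trace_elem\<close>, which vanishes at X = 1 as \<open>g\<close>
  does.\<close>

lemma gauss_mult: "gr_cong p m (g * g2) trace_elem"
  using gr_elem_mult[OF p_pos per per_sq, of m] by (simp only: conv_square)

lemma gauss_trace: "gr_cong p m (trace_elem * g) (smult (of_nat p) g)"
  using gr_elem_mult[OF p_pos per_trace per, of m "of_nat p - 1" "- 1"]
  by (simp only: conv_trace smult_gr_elem)

lemma gauss_cube: "gr_cong p m (g ^ 3) (smult J trace_elem)"
proof -
  have "g ^ 3 = g * (g * g)" by (simp add: power3_eq_cube mult.assoc)
  also have "gr_cong p m \<dots> (g * smult J g2)" by (intro gr_cong_mult_left gauss_square)
  also have "g * smult J g2 = smult J (g * g2)" by simp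
  also have "gr_cong p m \<dots> (smult J trace_elem)" by (intro gr_cong_smult gauss_mult)
  finally show ?thesis .
qed

text \<open>Each further factor \<open>g ^ 3\<close> contributes J and a \<open>trace_elem\<close>;
  the one factor \<open>g\<close> kept in reserve by the exponent 3 k + 1 turns the latter into
  p.\<close>

lemma gauss_power: "gr_cong p m (g ^ (3 * k + 1)) (smult ((of_nat p * J) ^ k) g)"
proof (induction k)
  case (Suc k)
  let ?c = "(of_nat p * J) ^ k"
  have "g ^ (3 * Suc k + 1) = g ^ 3 * g ^ (3 * k + 1)" by (subst power_add[symmetric]) simp
  also have "gr_cong p m \<dots> (smult J trace_elem * smult ?c g)"
    by (intro gr_cong_mult gauss_cube Suc)
  also have "smult J trace_elem * smult ?c g = smult (J * ?c) (trace_elem * g)"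
    by (simp add: mult.commute)
  also have "gr_cong p m \<dots> (smult (J * ?c) (smult (of_nat p) g))"
    by (intro gr_cong_smult gauss_trace)
  also have "smult (J * ?c) (smult (of_nat p) g) = smult ((of_nat p * J) ^ Suc k) g"
    by (simp add: mult_ac)
  finally show ?case .
qed simp

text \<open>The product \<open>g * g2 * g\<close> is evaluated in two ways, as p g and as the
  product of both Jacobi sums times g. With m = 0 the coefficients at 1 are equal.\<close>

lemma jacobi_mult: "J * jacobi_sum p (\<lambda>t. (\<chi> t)\<^sup>2) = of_nat p"
proof -
  let ?J2 = "jacobi_sum p (\<lambda>t. (\<chi> t)\<^sup>2)"
  have "gr_cong p 0 (smult (of_nat p) g) (trace_elem * g)"
    by (rule gr_cong_sym[OF gauss_trace])
  also have "gr_cong p 0 \<dots> (g * g2 * g)"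
    by (rule gr_cong_mult[OF gr_cong_sym[OF gauss_mult]]) simp
  also have "g * g2 * g = g2 * (g * g)" by (simp add: mult_ac)
  also have "gr_cong p 0 \<dots> (g2 * smult J g2)" by (intro gr_cong_mult_left gauss_square)
  also have "g2 * smult J g2 = smult J (g2 * g2)" by simp
  also have "gr_cong p 0 \<dots> (smult J (smult ?J2 g))" by (intro gr_cong_smult gauss_square_sq)
  finally have "gr_cong p 0 (gr_elem p (\<lambda>t. of_nat p * \<chi> t)) (gr_elem p (\<lambda>t. J * (?J2 * \<chi> t)))"
    by (simp only: smult_gr_elem)
  then have "0 dvd of_nat p * \<chi> 1 - J * (?J2 * \<chi> 1)"
    by (rule gr_elem_cong_dvd[OF p_pos, rotated 2]) (use per in \<open>auto simp: residues_per_def\<close>)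
  then show ?thesis by (simp add: one)
qed

lemma gauss_frobenius:
  assumes "prime q" "(int q * r) mod int p = 1 mod int p"
  shows "gr_cong p (of_nat q) (g ^ q) (gr_elem p (\<lambda>t. \<chi> (r * t) ^ q))"
  using gr_elem_frobenius[OF p_pos per assms] .

lemma per_scaled: "residues_per p (\<lambda>t. \<chi> (r * t) ^ n)"
  using residues_perD[OF per] unfolding residues_per_def by (metis mod_mult_right_eq)

lemma inverse_not_dvd:
  assumes "(a * r) mod int p = 1 mod int p" shows "\<not> int p dvd r"
proof
  assume "int p dvd r"
  then have "(a * r) mod int p = 0" by simp
  then show False using assms p_gt_1 by simp
qed

text \<open>The coefficient of \<open>g ^ 3\<close> at 1 is congruent to 1 by the Frobenius
  congruence for the prime 3 and to -J by \<open>gauss_cube\<close>, so J is -1, that is 2, modulo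
  3.\<close>

lemma jacobi_mod_3: "3 dvd J - 2"
proof -
  have per_J: "residues_per p (\<lambda>c. J * (if int p dvd c then of_nat p - 1 else - 1))"
    by (simp add: residues_per_def dvd_mod_iff)
  have "p > 3" using p_mod_3 p_gt_1 by presburger
  then have "\<not> int p dvd 3" by (auto dest: zdvd_imp_le)
  then obtain r where r: "(3 * r) mod int p = 1 mod int p" using inverse_exists by blast
  have "gr_cong p 3 (gr_elem p (\<lambda>t. \<chi> (r * t) ^ 3)) (g ^ 3)"
    using gauss_frobenius[of 3 r] r by (auto intro: gr_cong_sym)
  also have "gr_cong p 3 \<dots> (smult J trace_elem)" by (rule gauss_cube)
  finally have "3 dvd \<chi> (r * 1) ^ 3 - J * (if int p dvd 1 then of_nat p - 1 else - 1)"
    unfolding smult_gr_elem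
    by (rule gr_elem_cong_dvd[OF p_pos per_scaled per_J])
  then have "3 dvd 1 + J" using not_dvd_1 inverse_not_dvd[OF r] by (simp add: cube)
  then have "3 dvd (1 + J) - 3 * 1" by (rule dvd_diff) simp
  then show ?thesis by (simp add: algebra_simps)
qed

lemma per_smult: "residues_per p (\<lambda>t. c * \<chi> t)"
  using per by (simp add: residues_per_def)

text \<open>The coefficients at 1 of two expressions for \<open>g ^ q\<close> are compared, so
  \<open>g\<close> never has to be cancelled. As q is 1 modulo 3, the q-th power does not change
  \<open>\<chi> r\<close>.\<close>

lemma gauss_power_split:
  assumes "prime q" "(int q * r) mod int p = 1 mod int p" "q = 3 * k + 1"
  shows "of_nat q dvd (of_nat p * J) ^ k - \<chi> r"
proof -
  have "gr_cong p (of_nat q) (smult ((of_nat p * J) ^ k) g) (g ^ q)"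
    unfolding assms(3) by (rule gr_cong_sym[OF gauss_power])
  also have "gr_cong p (of_nat q) \<dots> (gr_elem p (\<lambda>t. \<chi> (r * t) ^ q))"
    by (rule gauss_frobenius[OF assms(1,2)])
  finally have "of_nat q dvd (of_nat p * J) ^ k * \<chi> 1 - \<chi> (r * 1) ^ q"
    unfolding smult_gr_elem
    by (rule gr_elem_cong_dvd[OF p_pos per_smult per_scaled])
  moreover have "\<chi> r ^ q = \<chi> r"
    using cube[OF inverse_not_dvd[OF assms(2)]] by (simp add: assms(3) power_mult)
  ultimately show ?thesis by (simp add: one)
qed

text \<open>Two applications of Frobenius scale the argument by r twice and raise values to the
  power q q, which is 1 modulo 3. Since r inverts q, the square of \<open>\<chi> r\<close> is
  \<open>\<chi> (int q)\<close>.\<close>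

lemma gauss_power_inert:
  assumes "prime q" "(int q * r) mod int p = 1 mod int p" "q * q = 3 * k + 1"
  shows "of_nat q dvd (of_nat p * J) ^ k - \<chi> (int q)"
proof -
  have per_scaled2: "residues_per p (\<lambda>t. (\<chi> (r * (r * t)) ^ q) ^ q)"
    using per by (simp add: residues_per_def mult)
  have "gr_cong p (of_nat q) (smult ((of_nat p * J) ^ k) g) ((g ^ q) ^ q)"
    unfolding power_mult[symmetric] assms(3) by (rule gr_cong_sym[OF gauss_power])
  also have "gr_cong p (of_nat q) \<dots> (gr_elem p (\<lambda>t. \<chi> (r * t) ^ q) ^ q)"
    by (intro gr_cong_power gauss_frobenius assms)
  also have "gr_cong p (of_nat q) \<dots> (gr_elem p (\<lambda>t. (\<chi> (r * (r * t)) ^ q) ^ q))"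
    by (rule gr_elem_frobenius[OF p_pos per_scaled assms(1,2)])
  finally have "of_nat q dvd (of_nat p * J) ^ k * \<chi> 1 - (\<chi> (r * (r * 1)) ^ q) ^ q"
    unfolding smult_gr_elem
    by (rule gr_elem_cong_dvd[OF p_pos per_smult per_scaled2])
  moreover have "(\<chi> (r * (r * 1)) ^ q) ^ q = \<chi> (int q)"
  proof -
    have r: "\<not> int p dvd r" using inverse_not_dvd[OF assms(2)] .
    have "\<chi> (r * r) ^ 3 = 1" using cube[OF r] by (simp add: mult power_mult_distrib)
    then have "(\<chi> (r * (r * 1)) ^ q) ^ q = \<chi> r * \<chi> r"
      by (simp add: assms(3) power_mult mult flip: power_mult[of _ q q])
    moreover have "\<chi> (int q) * \<chi> r = 1"
      using residues_perD[OF per assms(2)] by (simp add: mult one)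
    ultimately show ?thesis using cube[OF r]
      by (metis mult.assoc mult.commute mult_1 power3_eq_cube)
  qed
  ultimately show ?thesis by (simp add: one)
qed

end

subsection \<open>The Jacobi sum of a cubic residue character\<close>

text \<open>Scaling by a primitive root g permutes the residues and multiplies the sum by
  \<open>g ^ m\<close>, which is not 1 modulo p in this range of m.\<close>

lemma prime_dvd_sum_powers:
  assumes p: "prime p" and m: "0 < m" "m < p - 1"
  shows "int p dvd (\<Sum>a\<in>{0..<int p}. a ^ m)"
proof -
  let ?S = "\<Sum>a\<in>{0..<int p}. a ^ m"
  have p0: "p > 0" using p prime_gt_0_nat by blast
  obtain g where g: "\<not> p dvd g" "\<And>m. [g ^ m = 1] (mod p) \<Longrightarrow> p - 1 dvd m"
    using prime_primitive_root_power[OF p] by blast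
  have "coprime (int g) (int p)"
    using g(1) p prime_imp_coprime coprime_commute by (metis coprime_int_iff)
  then obtain h where h: "[int g * h = 1] (mod int p)" using cong_solve_coprime_int by blast
  have "(int g ^ m * ?S) mod int p = (\<Sum>a\<in>{0..<int p}. (int g * a) ^ m) mod int p"
    by (simp add: sum_distrib_left power_mult_distrib)
  also have "\<dots> = (\<Sum>a\<in>{0..<int p}. (int g * a) ^ m mod int p) mod int p"
    by (simp only: mod_sum_eq)
  also have "(\<Sum>a\<in>{0..<int p}. (int g * a) ^ m mod int p) = (\<Sum>a\<in>{0..<int p}. a ^ m mod int p)"
    using h by (intro sum_residues_scale[OF p0, where f = "\<lambda>a. a ^ m mod int p" and d = h])
      (auto simp: residues_per_def power_mod cong_def)
  also have "\<dots> mod int p = ?S mod int p" by (simp only: mod_sum_eq)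
  finally have "int p dvd int g ^ m * ?S - ?S" by (simp add: mod_eq_dvd_iff)
  then have "int p dvd (int g ^ m - 1) * ?S" by (simp add: algebra_simps)
  moreover have "\<not> int p dvd int g ^ m - 1"
  proof
    assume "int p dvd int g ^ m - 1"
    then have "[int (g ^ m) = int 1] (mod int p)" by (simp add: cong_iff_dvd_diff)
    then have "[g ^ m = 1] (mod p)" by (simp only: cong_int_iff)
    then have "p - 1 dvd m" by (rule g(2))
    then show False using m by (auto dest: dvd_imp_le)
  qed
  ultimately show ?thesis using p by (metis prime_dvd_mult_iff prime_nat_int_transfer)
qed

text \<open>Expanding the second factor leaves power sums with exponents from k to 2 k, all strictly
  between 0 and p - 1.\<close>

lemma prime_dvd_sum_power_prod:
  assumes p: "prime p" and k: "0 < k" "2 * k < p - 1"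
  shows "int p dvd (\<Sum>a\<in>{0..<int p}. a ^ k * (1 - a) ^ k)"
proof -
  let ?R = "{0..<int p}"
  have "(\<Sum>a\<in>?R. a ^ k * (1 - a) ^ k)
      = (\<Sum>a\<in>?R. \<Sum>j\<le>k. int (k choose j) * (- 1) ^ j * a ^ (k + j))"
  proof (rule sum.cong)
    fix a :: int
    have "(1 - a) ^ k = (- a + 1) ^ k" by simp
    also have "\<dots> = (\<Sum>j\<le>k. int (k choose j) * (- 1) ^ j * a ^ j)"
      unfolding binomial_ring by (simp add: power_minus[of a] mult.assoc)
    finally show "a ^ k * (1 - a) ^ k = (\<Sum>j\<le>k. int (k choose j) * (- 1) ^ j * a ^ (k + j))"
      by (simp add: sum_distrib_left power_add mult_ac)
  qed simp
  also have "\<dots> = (\<Sum>j\<le>k. int (k choose j) * (- 1) ^ j * (\<Sum>a\<in>?R. a ^ (k + j)))"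
    by (subst sum.swap) (simp add: sum_distrib_left)
  also have "int p dvd \<dots>"
    using k by (intro dvd_sum dvd_mult prime_dvd_sum_powers p) auto
  finally show ?thesis .
qed

lemma complex_of_eis_sum: "complex_of_eis (\<Sum>i\<in>A. f i) = (\<Sum>i\<in>A. complex_of_eis (f i))"
  by (induction A rule: infinite_finite_induct)
    (simp_all add: zero_eisenstein.rep_eq plus_eisenstein.rep_eq)

lemma cnj_root_of_unity:
  assumes "z = 0 \<or> z \<in> {1, eis_omega, eis_omega\<^sup>2}"
  shows "cnj (complex_of_eis z) = complex_of_eis (z\<^sup>2)"
proof -
  have "z \<in> {Eis 0 0, Eis 1 0, Eis 0 1, Eis (- 1) (- 1)}"
    using assms unfolding eis_omega_square by (auto simp: eis_omega_def Eis_0 Eis_1)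
  then show ?thesis
    by (auto simp: power2_eq_square Eis_times complex_of_Eis complex_eq_iff)
qed

section \<open>Primary primes of prime norm and their Jacobi sum\<close>

locale split_prime =
  fixes \<pi> :: eisenstein and p :: nat
  assumes prime_elem: "prime_elem \<pi>" and primary: "primary \<pi>"
    and prime_p: "prime p" and norm: "eis_norm \<pi> = int p"
begin

lemma p_mod_3: "p mod 3 = 1"
  using primary_norm_mod[OF primary] norm by presburger

lemma p_eq: "p = 3 * cubic_exp \<pi> + 1"
  using cubic_exp[OF primary] norm by simp

lemma dvd_p: "\<pi> dvd of_nat p"
  using dvd_of_int_eis_norm[of \<pi>] norm by simp

lemma dvd_of_int_iff: "\<pi> dvd of_int n \<longleftrightarrow> int p dvd n"
proof
  assume "\<pi> dvd of_int n"
  then have "int p dvd n\<^sup>2" using eis_norm_dvd[of \<pi> "of_int n"] norm by (simp add: eis_norm_of_int)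
  then show "int p dvd n" using prime_p by (metis prime_dvd_power prime_nat_int_transfer)
next
  assume "int p dvd n"
  then have "(of_nat p :: eisenstein) dvd of_int n"
    using of_int_dvd_of_int[where 'a = eisenstein] by force
  then show "\<pi> dvd of_int n" using dvd_p dvd_trans by blast
qed

lemma dvd_of_nat_iff: "\<pi> dvd of_nat n \<longleftrightarrow> p dvd n"
  using dvd_of_int_iff[of "int n"] by simp

abbreviation "\<chi> \<equiv> \<lambda>t. cubic_char \<pi> (of_int t)"

lemma cubic_exp_pos: "cubic_exp \<pi> > 0"
  using p_eq prime_gt_1_nat[OF prime_p] by (cases "cubic_exp \<pi>") auto

text \<open>The witness is a primitive root: character value 1 would make its power with exponent (p
  - 1) / 3 equal to 1 modulo p.\<close>

lemma nontrivial: "\<exists>u. \<not> int p dvd u \<and> \<chi> u \<noteq> 1"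
proof -
  obtain g where g: "\<not> p dvd g" "\<And>m. [g ^ m = 1] (mod p) \<Longrightarrow> p - 1 dvd m"
    using prime_primitive_root_power[OF prime_p] by blast
  have "\<chi> (int g) \<noteq> 1"
  proof
    assume "\<chi> (int g) = 1"
    then have "\<pi> dvd of_int (int g ^ cubic_exp \<pi> - 1)"
      using cubic_char_spec(2)[OF prime_elem primary, of "of_int (int g)"] g(1)
      by (simp add: dvd_of_nat_iff)
    then have "[int (g ^ cubic_exp \<pi>) = int 1] (mod int p)"
      unfolding dvd_of_int_iff by (simp add: cong_iff_dvd_diff)
    then have "p - 1 dvd cubic_exp \<pi>" using g(2) by (simp only: cong_int_iff)
    then show False using p_eq cubic_exp_pos by (auto dest: dvd_imp_le)
  qed
  then show ?thesis using g(1) by (metis int_dvd_int_iff)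
qed

sublocale cubic_character p \<chi>
proof
  show "residues_per p \<chi>"
    unfolding residues_per_def
  proof
    fix t
    have "int p dvd t mod int p - t" by (simp add: mod_eq_dvd_iff[symmetric])
    then have "\<pi> dvd of_int (t mod int p) - of_int t" by (simp flip: of_int_diff add: dvd_of_int_iff)
    then show "\<chi> (t mod int p) = \<chi> t" by (rule cubic_char_cong[OF prime_elem primary])
  qed
qed (use prime_p p_mod_3 nontrivial in
    \<open>auto simp: cubic_char_mult[OF prime_elem primary] cubic_char_cube[OF prime_elem primary] dvd_of_int_iff\<close>)

text \<open>Modulo \<pi> the value \<open>\<chi> a\<close> is \<open>a ^ k\<close> with k = (p - 1)
  / 3, also for multiples of p because k > 0. So J reduces to a sum covered by
  \<open>prime_dvd_sum_power_prod\<close>, as 2 k < p - 1.\<close>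

lemma dvd_jacobi: "\<pi> dvd J"
proof -
  let ?k = "cubic_exp \<pi>"
  have \<chi>: "\<pi> dvd of_int a ^ ?k - \<chi> a" for a
  proof (cases "\<pi> dvd of_int a")
    case True
    then show ?thesis using cubic_exp_pos by (simp add: dvd_power dvd_trans)
  next
    case False
    then show ?thesis by (rule cubic_char_spec(2)[OF prime_elem primary])
  qed
  have "\<pi> dvd (\<Sum>a\<in>R. of_int a ^ ?k * of_int (1 - a) ^ ?k - \<chi> a * \<chi> (1 - a))"
    by (intro dvd_sum dvd_mult_diff \<chi>)
  moreover have "(\<Sum>a\<in>R. of_int a ^ ?k * of_int (1 - a) ^ ?k - \<chi> a * \<chi> (1 - a))
      = of_int (\<Sum>a\<in>R. a ^ ?k * (1 - a) ^ ?k) - J"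
    by (simp add: jacobi_sum_def sum_subtractf)
  moreover have "\<pi> dvd of_int (\<Sum>a\<in>R. a ^ ?k * (1 - a) ^ ?k)"
    unfolding dvd_of_int_iff using cubic_exp_pos p_eq
    by (intro prime_dvd_sum_power_prod prime_p) auto
  ultimately show ?thesis by (metis dvd_diff_right_iff)
qed

text \<open>Conjugating a character value squares it, so the conjugate of J is the Jacobi sum of the
  squared character and \<open>jacobi_mult\<close> applies.\<close>

lemma eis_norm_jacobi: "eis_norm J = int p"
proof -
  let ?J2 = "jacobi_sum p (\<lambda>t. (\<chi> t)\<^sup>2)"
  have "cnj (complex_of_eis (\<chi> a)) = complex_of_eis ((\<chi> a)\<^sup>2)" for a
    using cubic_char_spec(1)[OF prime_elem primary, of "of_int a"] cubic_char_eq_0[of \<pi> "of_int a"]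
    by (intro cnj_root_of_unity) blast
  then have "cnj (complex_of_eis J) = complex_of_eis ?J2"
    by (simp add: jacobi_sum_def complex_of_eis_sum times_eisenstein.rep_eq del: of_int_diff)
  then have "of_int (eis_norm J) = complex_of_eis (J * ?J2)"
    by (simp add: of_int_eis_norm times_eisenstein.rep_eq)
  also have "\<dots> = of_int (int p)"
    by (simp add: jacobi_mult of_nat_eis complex_of_Eis)
  finally show ?thesis by (simp only: of_int_eq_iff)
qed

text \<open>Equal norms make the cofactor \<beta> a unit. As J and \<pi> are both 2 modulo 3,
  \<beta> is 1 modulo 3, which leaves only \<beta> = 1.\<close>

lemma jacobi_eq: "J = \<pi>"
proof -
  obtain \<beta> where \<beta>: "J = \<pi> * \<beta>" using dvd_jacobi by (auto simp: dvd_def)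
  obtain c d where cd: "\<beta> = Eis c d" by (cases \<beta>)
  have "int p * eis_norm \<beta> = int p"
    using eis_norm_jacobi norm by (simp add: \<beta> eis_norm_mult)
  then have N: "eis_norm \<beta> = 1" using prime_gt_0_nat[OF prime_p] by simp
  have "3 dvd \<pi> - 2" using primary by (simp add: primary_def eis_cong_def)
  then have "3 dvd (\<pi> - 2) * \<beta>" by (rule dvd_mult2)
  then have "3 dvd (J - 2) - (\<pi> - 2) * \<beta>" using jacobi_mod_3 by (rule dvd_diff[rotated])
  then have "3 dvd 2 * (\<beta> - 1)" by (simp add: \<beta> algebra_simps)
  \<comment> \<open>The factor 2 is removed by writing \<beta> - 1 as 4 (\<beta> - 1) - 3 (\<beta> -
    1).\<close>
  from dvd_diff[OF dvd_mult[OF this, of 2] dvd_triv_left[of 3 "\<beta> - 1"]]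
  have "of_int 3 dvd \<beta> - 1" by (simp add: algebra_simps)
  then have d: "3 dvd c - 1" "3 dvd d"
    unfolding cd Eis_1 Eis_minus of_int_dvd_Eis_iff by simp_all
  with N cd have "d = 0" "c = 1 \<or> c = - 1" using eis_norm_eq_1_cases by blast+
  with d(1) have "\<beta> = 1" by (auto simp: cd Eis_1)
  then show ?thesis by (simp add: \<beta>)
qed

text \<open>The inverse r of q is eliminated from \<open>gauss_power_split\<close>:
  \<open>\<chi> r\<close> is the inverse, hence the square, of the value at q.\<close>

lemma power_cong_split:
  assumes "prime q" "q \<noteq> p" "q = 3 * k + 1"
  shows "of_nat q dvd (of_nat p * \<pi>) ^ k - (cubic_char \<pi> (of_nat q))\<^sup>2"
proof -
  have q: "\<not> int p dvd int q" using assms(1,2) prime_p primes_dvd_imp_eq by auto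
  then obtain r where r: "(int q * r) mod int p = 1 mod int p" by (rule inverse_exists)
  have "\<chi> (int q) * \<chi> r = 1"
    using residues_perD[OF per r] one by (simp only: mult)
  moreover have "\<chi> (int q) ^ 3 = 1" using cube[OF q] .
  ultimately have "\<chi> r = (\<chi> (int q))\<^sup>2"
    by (metis mult.assoc mult.commute mult_1 power2_eq_square power3_eq_cube)
  then show ?thesis using gauss_power_split[OF assms(1) r assms(3)] by (simp add: jacobi_eq)
qed

lemma power_cong_inert:
  assumes "prime q" "q \<noteq> p" "q * q = 3 * k + 1"
  shows "of_nat q dvd (of_nat p * \<pi>) ^ k - cubic_char \<pi> (of_nat q)"
proof -
  have "\<not> int p dvd int q" using assms(1,2) prime_p primes_dvd_imp_eq by auto
  then obtain r where r: "(int q * r) mod int p = 1 mod int p" by (rule inverse_exists)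
  show ?thesis using gauss_power_inert[OF assms(1) r assms(3)] by (simp add: jacobi_eq)
qed

end

subsection \<open>Cubic reciprocity\<close>

text \<open>Reducing \<open>power_cong_split\<close> for the first prime modulo the second
  identifies its right side as the second character of
  \<open>of_nat p\<^sub>1 * \<pi>\<^sub>1\<close>.\<close>

lemma split_split_relation:
  assumes "split_prime \<pi>\<^sub>1 p\<^sub>1" "split_prime \<pi>\<^sub>2 p\<^sub>2" "p\<^sub>1 \<noteq> p\<^sub>2"
  shows "cubic_char \<pi>\<^sub>2 (of_nat p\<^sub>1) * cubic_char \<pi>\<^sub>2 \<pi>\<^sub>1 = (cubic_char \<pi>\<^sub>1 (of_nat p\<^sub>2))\<^sup>2"
    and "\<not> \<pi>\<^sub>2 dvd of_nat p\<^sub>1"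
proof -
  interpret A: split_prime \<pi>\<^sub>1 p\<^sub>1 by fact
  interpret B: split_prime \<pi>\<^sub>2 p\<^sub>2 by fact
  have n: "\<not> \<pi>\<^sub>2 dvd of_nat p\<^sub>1" "\<not> \<pi>\<^sub>1 dvd of_nat p\<^sub>2"
    using A.prime_p B.prime_p assms(3) primes_dvd_imp_eq
    by (auto simp: A.dvd_of_nat_iff B.dvd_of_nat_iff)
  then show "\<not> \<pi>\<^sub>2 dvd of_nat p\<^sub>1" by blast
  have "\<not> \<pi>\<^sub>2 dvd \<pi>\<^sub>1" using n(1) A.dvd_p dvd_trans by blast
  with n have "\<not> \<pi>\<^sub>2 dvd of_nat p\<^sub>1 * \<pi>\<^sub>1"
    using B.prime_elem by (simp add: prime_elem_dvd_mult_iff)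
  moreover have "(cubic_char \<pi>\<^sub>1 (of_nat p\<^sub>2))\<^sup>2 \<in> {1, eis_omega, eis_omega\<^sup>2}"
    by (subst power2_eq_square)
      (intro roots_of_unity_mult_closed cubic_char_spec(1) A.prime_elem A.primary n(2))
  moreover have "\<pi>\<^sub>2 dvd (of_nat p\<^sub>1 * \<pi>\<^sub>1) ^ cubic_exp \<pi>\<^sub>2 - (cubic_char \<pi>\<^sub>1 (of_nat p\<^sub>2))\<^sup>2"
    using A.power_cong_split[OF B.prime_p assms(3)[symmetric] B.p_eq] B.dvd_p dvd_trans by blast
  ultimately have "cubic_char \<pi>\<^sub>2 (of_nat p\<^sub>1 * \<pi>\<^sub>1) = (cubic_char \<pi>\<^sub>1 (of_nat p\<^sub>2))\<^sup>2"
    using cubic_char_eqI B.prime_elem B.primary by blast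
  then show "cubic_char \<pi>\<^sub>2 (of_nat p\<^sub>1) * cubic_char \<pi>\<^sub>2 \<pi>\<^sub>1 = (cubic_char \<pi>\<^sub>1 (of_nat p\<^sub>2))\<^sup>2"
    using cubic_char_mult B.prime_elem B.primary by simp
qed

text \<open>The relation is taken in both orders and solved by multiplying with the inverses of b
  and a, which are their squares; both unknown characters equal the product of the squares of a and
  b.\<close>

lemma cubic_reciprocity_split_split:
  assumes "split_prime \<pi>\<^sub>1 p\<^sub>1" "split_prime \<pi>\<^sub>2 p\<^sub>2" "p\<^sub>1 \<noteq> p\<^sub>2"
  shows "cubic_char \<pi>\<^sub>1 \<pi>\<^sub>2 = cubic_char \<pi>\<^sub>2 \<pi>\<^sub>1"
proof -
  interpret A: split_prime \<pi>\<^sub>1 p\<^sub>1 by fact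
  interpret B: split_prime \<pi>\<^sub>2 p\<^sub>2 by fact
  define a b where "a = cubic_char \<pi>\<^sub>1 (of_nat p\<^sub>2)" "b = cubic_char \<pi>\<^sub>2 (of_nat p\<^sub>1)"
  note rel = split_split_relation[OF assms] split_split_relation[OF assms(2,1) assms(3)[symmetric]]
  have x: "b * cubic_char \<pi>\<^sub>2 \<pi>\<^sub>1 = a\<^sup>2" and y: "a * cubic_char \<pi>\<^sub>1 \<pi>\<^sub>2 = b\<^sup>2"
    using rel by (simp_all add: a_b_def)
  have a: "a ^ 3 = 1" and b: "b ^ 3 = 1"
    using cubic_char_cube[OF A.prime_elem A.primary rel(4)]
      cubic_char_cube[OF B.prime_elem B.primary rel(2)] by (simp_all add: a_b_def)
  have "cubic_char \<pi>\<^sub>2 \<pi>\<^sub>1 = b\<^sup>2 * (b * cubic_char \<pi>\<^sub>2 \<pi>\<^sub>1)"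
    using b by (simp add: power2_eq_square power3_eq_cube mult.assoc[symmetric])
  also have "\<dots> = a\<^sup>2 * (a * cubic_char \<pi>\<^sub>1 \<pi>\<^sub>2)"
    unfolding x y by (rule mult.commute)
  also have "\<dots> = cubic_char \<pi>\<^sub>1 \<pi>\<^sub>2"
    using a by (simp add: power2_eq_square power3_eq_cube mult.assoc[symmetric])
  finally show ?thesis ..
qed

text \<open>The exponent (q q - 1) / 3 is the multiple (q - 1) m of q - 1 with m = (q + 1) / 3, so
  Fermat's theorem for integers applies.\<close>

lemma inert_cubic_char_of_nat:
  assumes "prime_elem (of_nat q :: eisenstein)" "primary (of_nat q)" "prime q" "q mod 3 = 2"
    and "\<not> q dvd n"
  shows "cubic_char (of_nat q) (of_nat n) = 1"
proof (rule cubic_char_eqI)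
  define m where "m = (q + 1) div 3"
  have q: "q = 3 * m - 1" "m > 0" using assms(4) unfolding m_def by presburger+
  have "3 * cubic_exp (of_nat q) + 1 = q * q"
    using cubic_exp[OF assms(2)] by (simp add: eis_norm_of_nat power2_eq_square nat_mult_distrib)
  also have "q * q = 3 * ((q - 1) * m) + 1"
    using q by (cases m) (auto simp: algebra_simps)
  finally have k: "cubic_exp (of_nat q) = (q - 1) * m" by simp
  have "[n ^ (q - 1) = 1] (mod q)" using fermat_theorem assms(3,5) by blast
  then have "[(n ^ (q - 1)) ^ m = 1 ^ m] (mod q)" by (rule cong_pow)
  then have "[int (n ^ cubic_exp (of_nat q)) = int 1] (mod int q)"
    unfolding cong_int_iff by (simp add: k power_mult)
  then have "int q dvd int n ^ cubic_exp (of_nat q) - 1" by (simp add: cong_iff_dvd_diff)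
  from of_int_dvd_of_int[OF this]
  show "of_nat q dvd (of_nat n :: eisenstein) ^ cubic_exp (of_nat q) - 1" by simp
  show "\<not> of_nat q dvd (of_nat n :: eisenstein)"
    using assms(5) of_int_dvd_of_int_eis_iff[of "int q" "int n"] by simp
qed (use assms in auto)

text \<open>By \<open>power_cong_inert\<close> the character modulo q of p \<pi> is the character
  modulo \<pi> of q. The factor p is then dropped because its character modulo q is 1.\<close>

lemma cubic_reciprocity_split_inert:
  assumes "split_prime \<pi> p"
    and q: "prime_elem (of_nat q :: eisenstein)" "primary (of_nat q)" "prime q" "q mod 3 = 2"
  shows "cubic_char \<pi> (of_nat q) = cubic_char (of_nat q) \<pi>"
proof -
  interpret split_prime \<pi> p by fact
  have "q \<noteq> p" using q(4) p_mod_3 by auto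
  then have n: "\<not> q dvd p" "\<not> p dvd q" using q(3) prime_p primes_dvd_imp_eq by blast+
  have "\<not> of_nat q dvd \<pi>"
  proof
    assume "of_nat q dvd \<pi>"
    then have "of_nat q dvd (of_nat p :: eisenstein)" using dvd_p dvd_trans by blast
    then show False using n of_int_dvd_of_int_eis_iff[of "int q" "int p"] by simp
  qed
  then have "\<not> of_nat q dvd of_nat p * \<pi>"
    using q(1) n of_int_dvd_of_int_eis_iff[of "int q" "int p"] by (simp add: prime_elem_dvd_mult_iff)
  moreover have "\<not> \<pi> dvd of_nat q" using n by (simp add: dvd_of_nat_iff)
  moreover have "q * q = 3 * cubic_exp (of_nat q) + 1"
    using cubic_exp[OF q(2)] by (simp add: eis_norm_of_nat power2_eq_square nat_mult_distrib)
  ultimately have "cubic_char (of_nat q) (of_nat p * \<pi>) = cubic_char \<pi> (of_nat q)"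
    using cubic_char_eqI[OF q(1,2)] cubic_char_spec(1)[OF prime_elem primary]
      power_cong_inert[OF q(3) \<open>q \<noteq> p\<close>] by blast
  then show ?thesis
    using cubic_char_mult[OF q(1,2)] inert_cubic_char_of_nat[OF q n(1)] by simp
qed

theorem theorem3p13:
  fixes \<pi>\<^sub>1 \<pi>\<^sub>2 :: eisenstein
  assumes "prime_elem \<pi>\<^sub>1" and "prime_elem \<pi>\<^sub>2"
    and "primary \<pi>\<^sub>1" and "primary \<pi>\<^sub>2"
    and "eis_norm \<pi>\<^sub>1 \<noteq> 3" and "eis_norm \<pi>\<^sub>2 \<noteq> 3"
    and "eis_norm \<pi>\<^sub>1 \<noteq> eis_norm \<pi>\<^sub>2"
  shows "cubic_char \<pi>\<^sub>1 \<pi>\<^sub>2 = cubic_char \<pi>\<^sub>2 \<pi>\<^sub>1"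
  using assms(1,3)
proof (cases rule: primary_prime_cases)
  case split1: (split p\<^sub>1)
  then have 1: "split_prime \<pi>\<^sub>1 p\<^sub>1" using assms by unfold_locales
  show ?thesis using assms(2,4)
  proof (cases rule: primary_prime_cases)
    case (split p\<^sub>2)
    then have "split_prime \<pi>\<^sub>2 p\<^sub>2" using assms by unfold_locales
    then show ?thesis using 1 split1 split assms(7) by (intro cubic_reciprocity_split_split) auto
  next
    case (inert q)
    then show ?thesis using cubic_reciprocity_split_inert[OF 1, of q] assms by simp
  qed
next
  case inert1: (inert q\<^sub>1)
  show ?thesis using assms(2,4)
  proof (cases rule: primary_prime_cases)
    case (split p\<^sub>2)
    then have "split_prime \<pi>\<^sub>2 p\<^sub>2" using assms by unfold_locales
    then show ?thesis using cubic_reciprocity_split_inert[of \<pi>\<^sub>2 p\<^sub>2 q\<^sub>1] inert1 assms by simp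
  next
    case (inert q\<^sub>2)
    have "q\<^sub>1 \<noteq> q\<^sub>2" using assms(7) inert1 inert by auto
    then have "\<not> q\<^sub>1 dvd q\<^sub>2" "\<not> q\<^sub>2 dvd q\<^sub>1" using inert1 inert primes_dvd_imp_eq by blast+
    \<comment> \<open>Both primes are rational integers here, so each character takes the value 1 at
      the other.\<close>
    then show ?thesis
      using inert_cubic_char_of_nat[of q\<^sub>1 q\<^sub>2] inert_cubic_char_of_nat[of q\<^sub>2 q\<^sub>1] inert1 inert assms
      by simp
  qed
qed

end
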